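(* Let $n\ge1$, $s\in(0,1)$ and let $u\in C^3(\mathbb{R}^n)\cap L^2_s(\mathbb{R}^n)$ be such that $G_u\in L^1_s(\mathbb{R}^n)$. If $(-\Delta)^su=0$ in $\mathbb{R}^n$ and $u$ is bounded from above or from below, then $u$ is constant.
   Context: $C_{n,s}:=\left(\int_{\mathbb{R}^n}\frac{1-\cos(\zeta_1)}{|\zeta|^{n+2s}}d\zeta\right)^{-1}$. For $1\le p<\infty$, $L^p_s(\mathbb{R}^n):=\{u\in L^1_{loc}:\int\frac{|u(x)|^p}{1+|x|^{n+2s}}dx<\infty\}$. $(-\Delta)^s u(x):=C_{n,s}\lim_{\epsilon\to0}\int_{\mathbb{R}^n\setminus B_\epsilon(x)}\frac{u(x)-u(y)}{|x-y|^{n+2s}}dy$. $G_u(y):=C_{n,s}\int_{\mathbb{R}^n}\frac{(u(y)-u(\eta))^2}{|y-\eta|^{n+2s}}d\eta$. *)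

theory Defs
  imports "HOL-Analysis.Analysis"
begin

fun Ck_on_UNIV :: "nat \<Rightarrow> ('a::euclidean_space \<Rightarrow> real) \<Rightarrow> bool" where
  "Ck_on_UNIV 0 f = continuous_on UNIV f"
| "Ck_on_UNIV (Suc k) f =
     ((\<forall>x. f differentiable (at x)) \<and>
      (\<forall>b\<in>Basis. Ck_on_UNIV k (\<lambda>x. frechet_derivative f (at x) b)))"

text \<open>The normalising constant C_{n,s}, n = DIM('a); zeta_1 is the coordinate along
  a fixed basis vector.\<close>
definition frac_const :: "'a::euclidean_space itself \<Rightarrow> real \<Rightarrow> real" where
  "frac_const _ s = 1 / (\<integral>\<zeta>. (1 - cos (\<zeta> \<bullet> (SOME b. b \<in> (Basis::'a set))))
                                / norm \<zeta> powr (real DIM('a) + 2 * s) \<partial>lborel)"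

definition L1_loc :: "('a::euclidean_space \<Rightarrow> real) \<Rightarrow> bool" where
  "L1_loc u \<longleftrightarrow> u \<in> borel_measurable lborel \<and>
     (\<forall>K. compact K \<longrightarrow> set_integrable lborel K u)"

definition Lps :: "real \<Rightarrow> real \<Rightarrow> ('a::euclidean_space \<Rightarrow> real) \<Rightarrow> bool" where
  "Lps p s u \<longleftrightarrow> L1_loc u \<and>
     (\<integral>\<^sup>+ x. ennreal (\<bar>u x\<bar> powr p / (1 + norm x powr (real DIM('a) + 2 * s))) \<partial>lborel) < \<infinity>"

definition has_frac_lap :: "real \<Rightarrow> ('a::euclidean_space \<Rightarrow> real) \<Rightarrow> 'a \<Rightarrow> real \<Rightarrow> bool" where
  "has_frac_lap s u x L \<longleftrightarrow>
     ((\<lambda>\<epsilon>. frac_const TYPE('a) s *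
         (\<integral>y\<in>(UNIV - ball x \<epsilon>). (u x - u y) / norm (x - y) powr (real DIM('a) + 2 * s) \<partial>lborel))
      \<longlongrightarrow> L) (at_right 0)"

definition frac_G :: "real \<Rightarrow> ('a::euclidean_space \<Rightarrow> real) \<Rightarrow> 'a \<Rightarrow> ennreal" where
  "frac_G s u y = ennreal (frac_const TYPE('a) s) *
     (\<integral>\<^sup>+ \<eta>. ennreal ((u y - u \<eta>)\<^sup>2 / norm (y - \<eta>) powr (real DIM('a) + 2 * s)) \<partial>lborel)"

text \<open>G_u \<in> L^1_s: G_u is measurable and its weighted integral is finite
  (this forces G_u to be finite a.e. and locally integrable).\<close>
definition G_in_L1s :: "real \<Rightarrow> ('a::euclidean_space \<Rightarrow> real) \<Rightarrow> bool" where
  "G_in_L1s s u \<longleftrightarrow> frac_G s u \<in> borel_measurable lborel \<and>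
     (\<integral>\<^sup>+ y. frac_G s u y / ennreal (1 + norm y powr (real DIM('a) + 2 * s)) \<partial>lborel) < \<infinity>"

end

(*
  The proof is a Harnack inequality obtained from touching arguments alone; neither Fourier analysis
  nor Poisson kernels enter.  Let u be nonnegative and s-harmonic, and write
  I = \<integral> u(y) / (1 + |y|^(n+2s)) dy.

  Weak Harnack: touch u from below by the paraboloid c - T |x|^2 with T slightly above u(x1), |x1| \<le> 1.
  At the touching point the equation balances the tail of u against T, whence I \<le> C u(x1).

  Local boundedness: touch u from above by the barrier t (1 - |x|^2)^(-n) at x0, put d = 1 - |x0|^2.
  If I were much smaller than t, then u would be below u(x0)/2 on most of the ball of radius r d about
  x0, and there (-\<Delta>)^s u(x0) > 0 once r is small.  Hence u(0) \<le> t \<le> C I.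

  Together u(0) \<le> C u(x1) for |x1| \<le> 1; translating and dilating gives u(x) \<le> C u(y) for all x, y.
  Applied to u - inf u this forces u to be constant.
*)

theory Submission
  imports Defs
begin

text \<open>The equation at a point is only a limit of truncated integrals, and its integrand need
  not be absolutely integrable. Touching supplies a one-sided bound on that integrand: the gradient
  of the touching function is odd and cancels on every truncation, and the second-order error is
  integrable against the kernel because s < 1. Each estimate thus reduces to the sign of the
  integral of one explicit integrable function.

  In the second estimate the touching point x0 may lie arbitrarily close to the unit sphere, so
  lengths must be measured in units of d. The exponent n of the barrier is made for this: u(x0)
  times the volume of the ball of radius r d is a fixed multiple of u(x0) d^n = t, and d disappears
  from the result. On that ball the gain has order u(x0) (r d)^(-2s), while the curvature of the
  barrier costs about r^2 times as much; hence a small r suffices.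

  Since nonnegative s-harmonic functions are preserved by dilations, the constant found at unit
  scale serves for points at any distance, and no iteration over chains of balls occurs.\<close>

section \<open>Affine substitution and integrability over dyadic balls\<close>

lemma
  fixes f :: "'a::euclidean_space \<Rightarrow> real" and t :: 'a
  assumes "c \<noteq> 0"
  shows lborel_integrable_affine: "integrable lborel f \<Longrightarrow> integrable lborel (\<lambda>x. f (t + c *\<^sub>R x))"
    and lborel_integral_affine: "f \<in> borel_measurable borel \<Longrightarrow>
      (\<integral>x. f x \<partial>lborel) = \<bar>c\<bar> ^ DIM('a) * (\<integral>x. f (t + c *\<^sub>R x) \<partial>lborel)"
proof -
  assume f: "integrable lborel f"
  then have [measurable]: "f \<in> borel_measurable borel"
    by (simp add: borel_measurable_integrable)
  have "integrable (density (distr lborel borel (\<lambda>x. t + c *\<^sub>R x)) (\<lambda>_. ennreal (\<bar>c\<bar> ^ DIM('a)))) f"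
    using f lborel_affine[OF assms, of t] by simp
  then show "integrable lborel (\<lambda>x. f (t + c *\<^sub>R x))"
    using assms by (simp add: integrable_density integrable_distr_eq)
next
  assume f[measurable]: "f \<in> borel_measurable borel"
  have "(\<integral>x. f x \<partial>lborel) =
      (\<integral>x. f x \<partial>density (distr lborel borel (\<lambda>x. t + c *\<^sub>R x)) (\<lambda>_. ennreal (\<bar>c\<bar> ^ DIM('a))))"
    using lborel_affine[OF assms, of t] by simp
  then show "(\<integral>x. f x \<partial>lborel) = \<bar>c\<bar> ^ DIM('a) * (\<integral>x. f (t + c *\<^sub>R x) \<partial>lborel)"
    by (simp add: integral_density integral_distr)
qed

lemma pred_ball [measurable]:
  "Measurable.pred borel (\<lambda>x. x \<in> ball (a::'a::euclidean_space) r)"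
  "Measurable.pred borel (\<lambda>x. x \<in> cball a r)"
  by (simp_all add: pred_def)

text \<open>This takes the place of polar coordinates: \<open>g\<close> lies below the series of
  constants \<open>a k\<close> on balls of radius \<open>r k\<close>, so only the volume of a ball
  is needed. One suitable index per point is enough because all terms of the series are
  nonnegative.\<close>

lemma integrable_dyadic:
  fixes g :: "'a::euclidean_space \<Rightarrow> real" and a r :: "nat \<Rightarrow> real"
  assumes [measurable]: "g \<in> borel_measurable borel"
    and a: "\<And>k. 0 \<le> a k" and r: "\<And>k. 0 \<le> r k"
    and sum: "summable (\<lambda>k. a k * r k ^ DIM('a))"
    and g: "\<And>z. 0 \<le> g z" "\<And>z. g z \<noteq> 0 \<Longrightarrow> \<exists>k. norm z \<le> r k \<and> g z \<le> a k"
  shows "integrable lborel g"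
proof (rule integrableI_nonneg)
  have "ennreal (g z) \<le> (\<Sum>k. ennreal (a k) * indicator (cball 0 (r k)) z)" for z
  proof (cases "g z = 0")
    case False
    then obtain k where k: "norm z \<le> r k" "g z \<le> a k" using g(2) by blast
    define F where "F k = ennreal (a k) * indicator (cball 0 (r k)) z" for k
    have "ennreal (g z) \<le> F k"
      using k by (simp add: ennreal_leI F_def)
    also have "\<dots> = (\<Sum>k\<in>{k}. F k)" by simp
    also have "\<dots> \<le> (\<Sum>k. F k)"
      by (rule sum_le_suminf) auto
    also have "\<dots> = (\<Sum>k. ennreal (a k) * indicator (cball 0 (r k)) z)"
      by (simp add: F_def)
    finally show ?thesis .
  qed auto
  then have "(\<integral>\<^sup>+z. ennreal (g z) \<partial>lborel) \<le> (\<integral>\<^sup>+z. (\<Sum>k. ennreal (a k) * indicator (cball (0::'a) (r k)) z) \<partial>lborel)"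
    by (intro nn_integral_mono)
  also have "\<dots> = (\<Sum>k. \<integral>\<^sup>+z. ennreal (a k) * indicator (cball (0::'a) (r k)) z \<partial>lborel)"
    by (rule nn_integral_suminf) measurable
  also have "\<dots> = (\<Sum>k. ennreal (unit_ball_vol (real DIM('a)) * (a k * r k ^ DIM('a))))"
  proof (intro suminf_cong)
    fix k
    have "(\<integral>\<^sup>+z. ennreal (a k) * indicator (cball (0::'a) (r k)) z \<partial>lborel)
        = ennreal (a k) * ennreal (unit_ball_vol (real DIM('a)) * r k ^ DIM('a))"
      using r by (subst nn_integral_cmult_indicator) (auto simp: emeasure_cball)
    also have "\<dots> = ennreal (unit_ball_vol (real DIM('a)) * (a k * r k ^ DIM('a)))"
      using a r by (subst ennreal_mult[symmetric]) (auto simp: mult_ac)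
    finally show "(\<integral>\<^sup>+z. ennreal (a k) * indicator (cball (0::'a) (r k)) z \<partial>lborel)
        = ennreal (unit_ball_vol (real DIM('a)) * (a k * r k ^ DIM('a)))" .
  qed
  also have "\<dots> < \<infinity>"
    using a r summable_mult[OF sum, of "unit_ball_vol (real DIM('a))"]
    by (subst suminf_ennreal2) auto
  finally show "(\<integral>\<^sup>+z. ennreal (g z) \<partial>lborel) < \<infinity>" .
qed (use g in auto)

section \<open>The kernel and the weight\<close>

text \<open>At the origin division by zero gives the default value 0, so lower bounds on
  \<open>kern\<close> must exclude that point.\<close>

definition kern :: "real \<Rightarrow> 'a::euclidean_space \<Rightarrow> real"
  where "kern s z = 1 / norm z powr (real DIM('a) + 2 * s)"

definition wt :: "real \<Rightarrow> 'a::euclidean_space \<Rightarrow> real"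
  where "wt s y = 1 / (1 + norm y powr (real DIM('a) + 2 * s))"

lemma kern_nonneg [simp]: "0 \<le> kern s z"
  by (simp add: kern_def)

lemma wt_pos [simp]: "0 < wt s y"
  by (simp add: wt_def add_pos_nonneg)

lemma wt_nonneg [simp]: "0 \<le> wt s y"
  using wt_pos less_imp_le by blast

lemma kern_minus [simp]: "kern s (- z) = kern s z"
  by (simp add: kern_def)

lemma kern_scaleR:
  "0 < c \<Longrightarrow> kern s (c *\<^sub>R z :: 'a::euclidean_space) = kern s z / c powr (real DIM('a) + 2 * s)"
  by (simp add: kern_def powr_mult)

lemma borel_measurable_kern [measurable]: "kern s \<in> borel_measurable borel"
  unfolding kern_def by measurable

lemma borel_measurable_wt [measurable]: "wt s \<in> borel_measurable borel"
  unfolding wt_def by measurable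

lemma kern_antimono:
  assumes "0 < s" "0 < r" "r \<le> norm (z::'a::euclidean_space)"
  shows "kern s z \<le> 1 / r powr (real DIM('a) + 2 * s)"
  unfolding kern_def using assms by (intro divide_left_mono powr_mono2 mult_pos_pos) auto

lemma kern_ge:
  assumes "0 < s" "norm (z::'a::euclidean_space) \<le> r" "z \<noteq> 0"
  shows "1 / r powr (real DIM('a) + 2 * s) \<le> kern s z"
proof -
  have "0 < r" using assms by (meson less_le_trans zero_less_norm_iff)
  then show ?thesis
    unfolding kern_def using assms by (intro divide_left_mono powr_mono2 mult_pos_pos) auto
qed

lemma ex_dyadic:
  fixes x :: real
  assumes "1 \<le> x"
  shows "\<exists>k. 2 ^ k \<le> x \<and> x \<le> 2 ^ (k + 1)"
proof -
  define k where "k = nat \<lfloor>log 2 x\<rfloor>"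
  have 1: "0 \<le> log 2 x" using assms by simp
  have "2 ^ k = 2 powr real k" by (simp add: powr_realpow)
  also have "\<dots> \<le> 2 powr log 2 x" using 1 by (intro powr_mono) (auto simp: k_def)
  finally have "2 ^ k \<le> x" using assms by simp
  moreover have "x = 2 powr log 2 x" using assms by simp
  then have "x \<le> 2 powr real (k + 1)"
    using 1 powr_mono[of "log 2 x" "real (k+1)" 2] unfolding k_def by linarith
  then have "x \<le> 2 ^ (k + 1)" by (simp only: powr_realpow)
  ultimately show ?thesis by blast
qed

text \<open>The shell between radii 2^k and 2^(k+1) contributes at most a multiple of 2^(-2sk), a
  geometric series because s > 0.\<close>

lemma integrable_kern_far:
  assumes "0 < s"
  shows "integrable lborel (\<lambda>z::'a::euclidean_space. indicator (- ball 0 1) z * kern s z)"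
proof (rule integrable_dyadic[where a="\<lambda>k. 1 / (2 ^ k) powr (real DIM('a) + 2 * s)" and r="\<lambda>k. 2 ^ (k + 1)"])
  let ?p = "real DIM('a) + 2 * s"
  have "1 / (2 ^ k) powr ?p * (2 ^ (k + 1)) ^ DIM('a) = 2 ^ DIM('a) * (2 powr (- (2 * s))) ^ k" for k
  proof -
    have 1: "(2 ^ k :: real) = 2 powr real k" for k
      by (simp add: powr_realpow)
    have 2: "(2 powr x) ^ m = 2 powr (x * real m)" for x :: real and m
      by (simp add: powr_power mult.commute)
    have 3: "1 / (2::real) powr x = 2 powr (- x)" for x
      by (simp add: powr_minus field_simps)
    show ?thesis
      unfolding 1 powr_powr 2 3 powr_add[symmetric]
      by (simp add: algebra_simps)
  qed
  moreover have "summable (\<lambda>k. 2 ^ DIM('a) * (2 powr (- (2 * s))) ^ k)"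
    using assms by (intro summable_mult summable_geometric) (auto simp: powr_less_one)
  ultimately show "summable (\<lambda>k. 1 / (2 ^ k) powr ?p * (2 ^ (k + 1)) ^ DIM('a))"
    by simp
  fix z :: 'a
  assume "indicator (- ball 0 1) z * kern s z \<noteq> 0"
  then have z: "1 \<le> norm z" by (auto simp: indicator_def split: if_splits)
  then obtain k where "2 ^ k \<le> norm z" "norm z \<le> 2 ^ (k + 1)" using ex_dyadic by blast
  then show "\<exists>k. norm z \<le> 2 ^ (k + 1) \<and> indicator (- ball 0 1) z * kern s z \<le> 1 / (2 ^ k) powr ?p"
    using z assms kern_antimono[of s "2 ^ k" z] by (intro exI[of _ k]) auto
qed auto

text \<open>The shell of radius about 2^(-k) contributes at most a multiple of 2^((2s-2)k).
  Convergence is where s < 1 enters: it makes second-order errors of touching functions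
  integrable.\<close>

lemma integrable_kern_near:
  assumes "0 < s" "s < 1"
  shows "integrable lborel (\<lambda>z::'a::euclidean_space. indicator (ball 0 1) z * ((norm z)\<^sup>2 * kern s z))"
proof (rule integrable_dyadic[where a="\<lambda>k. (1 / 2 ^ k)\<^sup>2 * (1 / (1 / 2 ^ (k + 1)) powr (real DIM('a) + 2 * s))" and r="\<lambda>k. 1 / 2 ^ k"])
  let ?p = "real DIM('a) + 2 * s"
  have "(1 / 2 ^ k)\<^sup>2 * (1 / (1 / 2 ^ (k + 1)) powr ?p) * (1 / 2 ^ k) ^ DIM('a)
      = 2 powr ?p * (2 powr (2 * s - 2)) ^ k" for k
  proof -
    have 1: "(1 / 2 ^ k :: real) = 2 powr (- real k)" for k
      by (simp add: powr_minus powr_realpow field_simps)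
    have 2: "(2 powr x) ^ m = 2 powr (x * real m)" for x :: real and m
      by (simp add: powr_power mult.commute)
    have 3: "1 / (2::real) powr x = 2 powr (- x)" for x
      by (simp add: powr_minus field_simps)
    show ?thesis
      unfolding 1 2 3 powr_powr powr_add[symmetric]
      by (simp add: algebra_simps)
  qed
  moreover have "summable (\<lambda>k. 2 powr ?p * (2 powr (2 * s - 2)) ^ k)"
    using assms powr_less_mono[of "2 * s - 2" 0 2] by (intro summable_mult summable_geometric) auto
  ultimately show "summable (\<lambda>k. (1 / 2 ^ k)\<^sup>2 * (1 / (1 / 2 ^ (k + 1)) powr ?p) * (1 / 2 ^ k) ^ DIM('a))"
    by simp
  fix z :: 'a
  assume "indicator (ball 0 1) z * ((norm z)\<^sup>2 * kern s z) \<noteq> 0"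
  then have z: "norm z < 1" "z \<noteq> 0" by (auto simp: indicator_def split: if_splits)
  then have "1 \<le> 1 / norm z" by simp
  then obtain k where k: "2 ^ k \<le> 1 / norm z" "1 / norm z \<le> 2 ^ (k + 1)" using ex_dyadic by blast
  then have k: "norm z \<le> 1 / 2 ^ k" "1 / 2 ^ (k + 1) \<le> norm z"
    using z by (simp_all add: field_simps)
  then have "(norm z)\<^sup>2 * kern s z \<le> (1 / 2 ^ k)\<^sup>2 * (1 / (1 / 2 ^ (k + 1)) powr ?p)"
    using assms by (intro mult_mono power_mono kern_antimono) auto
  then show "\<exists>k. norm z \<le> 1 / 2 ^ k \<and> indicator (ball 0 1) z * ((norm z)\<^sup>2 * kern s z)
      \<le> (1 / 2 ^ k)\<^sup>2 * (1 / (1 / 2 ^ (k + 1)) powr ?p)"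
    using z k by (intro exI[of _ k]) auto
next
  show "(\<lambda>z::'a. indicator (ball 0 1) z * ((norm z)\<^sup>2 * kern s z)) \<in> borel_measurable borel"
    by measurable
qed auto

section \<open>Touching functions and the principal value\<close>

lemma set_integral_ball_complement_tendsto:
  fixes H :: "'a::euclidean_space \<Rightarrow> real"
  assumes "integrable lborel H"
  shows "((\<lambda>\<epsilon>. \<integral>y\<in>(UNIV - ball x \<epsilon>). H y \<partial>lborel) \<longlongrightarrow> (\<integral>y. H y \<partial>lborel)) (at_right 0)"
proof (rule tendsto_at_right_sequentially[where b=1])
  fix e :: "nat \<Rightarrow> real"
  assume e: "\<And>n. 0 < e n" "e \<longlonglongrightarrow> 0"
  have H[measurable]: "H \<in> borel_measurable borel"
    using assms by (simp add: borel_measurable_integrable)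
  show "(\<lambda>n. \<integral>y\<in>(UNIV - ball x (e n)). H y \<partial>lborel) \<longlonglongrightarrow> (\<integral>y. H y \<partial>lborel)"
    unfolding set_lebesgue_integral_def
  proof (rule integral_dominated_convergence[where w="\<lambda>y. \<bar>H y\<bar>"])
    have "(\<lambda>n. indicator (UNIV - ball x (e n)) y *\<^sub>R H y) \<longlonglongrightarrow> H y" if "y \<noteq> x" for y
    proof (rule tendsto_eventually)
      have "eventually (\<lambda>n. e n < dist x y) sequentially"
        using e(2) that by (intro order_tendstoD(2)) auto
      then show "eventually (\<lambda>n. indicator (UNIV - ball x (e n)) y *\<^sub>R H y = H y) sequentially"
        by eventually_elim auto
    qed
    then show "AE y in lborel. (\<lambda>n. indicator (UNIV - ball x (e n)) y *\<^sub>R H y) \<longlonglongrightarrow> H y"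
      using AE_lborel_singleton[of x] by (auto elim!: eventually_mono)
  qed (use assms in \<open>auto simp: indicator_def\<close>)
qed auto

text \<open>The reflection of \<open>y\<close> in \<open>x\<close> preserves Lebesgue measure and
  \<open>A\<close> but reverses the sign of the integrand, so the integral equals its own negative.
  No integrability is assumed; in its absence the default value 0 agrees.\<close>

lemma set_integral_odd:
  fixes x b :: "'a::euclidean_space"
  assumes [measurable]: "A \<in> sets borel" and A: "\<And>y. 2 *\<^sub>R x - y \<in> A \<longleftrightarrow> y \<in> A"
  shows "(\<integral>y\<in>A. (b \<bullet> (y - x)) * kern s (y - x) \<partial>lborel) = 0"
proof -
  define g where "g y = indicator A y *\<^sub>R ((b \<bullet> (y - x)) * kern s (y - x))" for y
  have [measurable]: "g \<in> borel_measurable borel"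
    unfolding g_def by measurable
  have "g (2 *\<^sub>R x + (-1) *\<^sub>R y) = - g y" for y
  proof -
    have "2 *\<^sub>R x + (-1) *\<^sub>R y - x = - (y - x)" by (simp add: scaleR_2)
    moreover have "2 *\<^sub>R x + (-1) *\<^sub>R y \<in> A \<longleftrightarrow> y \<in> A" using A[of y] by simp
    ultimately show ?thesis
      unfolding g_def by (simp only: indicator_def inner_minus_right kern_minus) simp
  qed
  then have "(\<integral>y. g y \<partial>lborel) = - (\<integral>y. g y \<partial>lborel)"
    using lborel_integral_affine[of "-1" g "2 *\<^sub>R x"] by simp
  then show ?thesis
    by (simp add: set_lebesgue_integral_def g_def[abs_def])
qed

text \<open>The term with \<open>b\<close> is the gradient of the touching function: it is odd about \<open>x\<close>, so it drops out of
  the truncated integrals although it need not be absolutely integrable.\<close>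

lemma pv_upper:
  fixes f :: "'a::euclidean_space \<Rightarrow> real"
  assumes s: "0 < s" and \<rho>: "0 < \<rho>"
    and f: "\<And>\<epsilon>. 0 < \<epsilon> \<Longrightarrow> set_integrable lborel (UNIV - ball x \<epsilon>) f"
    and lim: "((\<lambda>\<epsilon>. \<integral>y\<in>(UNIV - ball x \<epsilon>). f y \<partial>lborel) \<longlongrightarrow> 0) (at_right 0)"
    and H: "integrable lborel H"
    and le: "\<And>y. y \<noteq> x \<Longrightarrow> f y \<le> indicator (ball x \<rho>) y * ((b \<bullet> (y - x)) * kern s (y - x)) + H y"
  shows "0 \<le> (\<integral>y. H y \<partial>lborel)"
proof (rule tendsto_le[OF _ set_integral_ball_complement_tendsto[OF H, of x] lim])
  have "(\<integral>y\<in>(UNIV - ball x \<epsilon>). f y \<partial>lborel) \<le> (\<integral>y\<in>(UNIV - ball x \<epsilon>). H y \<partial>lborel)"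
    if \<epsilon>: "0 < \<epsilon>" for \<epsilon>
  proof -
    let ?A = "UNIV - ball x \<epsilon>"
    let ?o = "\<lambda>y. indicator (ball x \<rho>) y * ((b \<bullet> (y - x)) * kern s (y - x))"
    have o: "set_integrable lborel ?A ?o"
      unfolding set_integrable_def
    proof (rule Bochner_Integration.integrable_bound)
      let ?B = "norm b * \<rho> * (1 / \<epsilon> powr (real DIM('a) + 2 * s))"
      show "integrable lborel (\<lambda>y. ?B * indicator (ball x \<rho>) y)"
        using emeasure_lborel_ball_finite[of x \<rho>] by (intro integrable_mult_right integrable_real_indicator) auto
      have "\<bar>b \<bullet> (y - x)\<bar> * kern s (y - x) \<le> ?B"
        if "\<epsilon> \<le> norm (y - x)" "norm (y - x) < \<rho>" for y
      proof (intro mult_mono kern_antimono)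
        have "\<bar>b \<bullet> (y - x)\<bar> \<le> norm b * norm (y - x)" by (rule Cauchy_Schwarz_ineq2)
        also have "\<dots> \<le> norm b * \<rho>" using that by (intro mult_left_mono) auto
        finally show "\<bar>b \<bullet> (y - x)\<bar> \<le> norm b * \<rho>" .
        show "0 \<le> norm b * \<rho>"
          using that \<epsilon> by (intro mult_nonneg_nonneg) auto
      qed (use that \<epsilon> s in auto)
      then have *: "norm (indicator ?A y *\<^sub>R ?o y) \<le> ?B * indicator (ball x \<rho>) y" for y
        using \<rho> by (cases "y \<in> ?A"; cases "y \<in> ball x \<rho>")
          (auto simp: abs_mult dist_norm norm_minus_commute[of x] not_less)
      have "norm (indicator ?A y *\<^sub>R ?o y) \<le> norm (?B * indicator (ball x \<rho>) y)" for y
        using *[of y] unfolding real_norm_def by (rule order_trans[OF _ abs_ge_self])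
      then show "AE y in lborel. norm (indicator ?A y *\<^sub>R ?o y) \<le> norm (?B * indicator (ball x \<rho>) y)"
        by simp
    qed measurable
    have Hs: "set_integrable lborel ?A H"
      unfolding set_integrable_def by (rule integrable_mult_indicator[OF _ H]) auto
    have "(\<integral>y\<in>?A. f y \<partial>lborel) \<le> (\<integral>y\<in>?A. ?o y + H y \<partial>lborel)"
    proof (intro set_integral_mono set_integral_add(1))
      show "f y \<le> ?o y + H y" if "y \<in> ?A" for y
        using that \<epsilon> by (intro le) auto
    qed (use f[OF \<epsilon>] o Hs in auto)
    also have "\<dots> = (\<integral>y\<in>?A. ?o y \<partial>lborel) + (\<integral>y\<in>?A. H y \<partial>lborel)"
      using o Hs by (rule set_integral_add)
    \<comment> \<open>The truncation and the cutoff ball are both centred at \<open>x\<close>, so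
      the remaining annulus is symmetric about \<open>x\<close>.\<close>
    also have "(\<integral>y\<in>?A. ?o y \<partial>lborel)
        = (\<integral>y\<in>(?A \<inter> ball x \<rho>). (b \<bullet> (y - x)) * kern s (y - x) \<partial>lborel)"
      unfolding set_lebesgue_integral_def by (intro Bochner_Integration.integral_cong) (auto simp: indicator_def)
    also have "\<dots> = 0"
    proof (rule set_integral_odd)
      have "dist x (2 *\<^sub>R x - y) = dist x y" for y
        by (simp add: dist_norm scaleR_2 norm_minus_commute)
      then show "2 *\<^sub>R x - y \<in> ?A \<inter> ball x \<rho> \<longleftrightarrow> y \<in> ?A \<inter> ball x \<rho>" for y
        by simp
    qed auto
    finally show ?thesis by simp
  qed
  then show "eventually (\<lambda>\<epsilon>. (\<integral>y\<in>(UNIV - ball x \<epsilon>). f y \<partial>lborel)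
      \<le> (\<integral>y\<in>(UNIV - ball x \<epsilon>). H y \<partial>lborel)) (at_right 0)"
    by (auto simp: eventually_at_right_field intro!: exI[of _ 1])
qed simp

lemma pv_lower:
  fixes f :: "'a::euclidean_space \<Rightarrow> real"
  assumes s: "0 < s" and \<rho>: "0 < \<rho>"
    and f: "\<And>\<epsilon>. 0 < \<epsilon> \<Longrightarrow> set_integrable lborel (UNIV - ball x \<epsilon>) f"
    and lim: "((\<lambda>\<epsilon>. \<integral>y\<in>(UNIV - ball x \<epsilon>). f y \<partial>lborel) \<longlongrightarrow> 0) (at_right 0)"
    and H: "integrable lborel H"
    and ge: "\<And>y. y \<noteq> x \<Longrightarrow> indicator (ball x \<rho>) y * ((b \<bullet> (y - x)) * kern s (y - x)) + H y \<le> f y"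
  shows "(\<integral>y. H y \<partial>lborel) \<le> 0"
proof -
  have "0 \<le> (\<integral>y. - H y \<partial>lborel)"
  proof (rule pv_upper[OF s \<rho>])
    show "set_integrable lborel (UNIV - ball x \<epsilon>) (\<lambda>y. - f y)" if "0 < \<epsilon>" for \<epsilon>
      using f[OF that] by (simp add: set_integrable_def)
    show "((\<lambda>\<epsilon>. \<integral>y\<in>(UNIV - ball x \<epsilon>). - f y \<partial>lborel) \<longlongrightarrow> 0) (at_right 0)"
      using tendsto_minus[OF lim] by (simp add: set_lebesgue_integral_def)
    show "integrable lborel (\<lambda>y. - H y)" using H by simp
    show "- f y \<le> indicator (ball x \<rho>) y * ((- b \<bullet> (y - x)) * kern s (y - x)) + - H y" if "y \<noteq> x" for y
      using ge[OF that] by simp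
  qed
  then show ?thesis by simp
qed

section \<open>Scaling of the kernel and its comparison with the weight\<close>

text \<open>The exponent is n from the volume, 2 from the square and -(n+2s) from the kernel. It
  exceeds by 2 the exponent -2s of the gain in the barrier argument, so curvature errors lose on
  small balls.\<close>

lemma integral_kern_near_scaled:
  fixes x :: "'a::euclidean_space"
  assumes s: "0 < s" "s < 1" and \<rho>: "0 < \<rho>"
  shows "integrable lborel (\<lambda>y. indicator (ball x \<rho>) y * ((norm (y - x))\<^sup>2 * kern s (y - x)))" (is ?I)
    and "(\<integral>y. indicator (ball x \<rho>) y * ((norm (y - x))\<^sup>2 * kern s (y - x)) \<partial>lborel)
      = \<rho> powr (2 - 2 * s) * (\<integral>z. indicator (ball 0 1) (z::'a) * ((norm z)\<^sup>2 * kern s z) \<partial>lborel)" (is ?E)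
proof -
  let ?f = "\<lambda>y. indicator (ball x \<rho>) y * ((norm (y - x))\<^sup>2 * kern s (y - x))"
  let ?g = "\<lambda>z::'a. indicator (ball 0 1) z * ((norm z)\<^sup>2 * kern s z)"
  let ?p = "real DIM('a) + 2 * s"
  have f[measurable]: "?f \<in> borel_measurable borel" by measurable
  have eq: "?f (x + \<rho> *\<^sub>R z) = \<rho>\<^sup>2 / \<rho> powr ?p * ?g z" for z
    using \<rho> by (auto simp: indicator_def dist_norm kern_scaleR power_mult_distrib)
  have g: "integrable lborel ?g" by (rule integrable_kern_near[OF s])
  have "integrable lborel (\<lambda>z. \<rho>\<^sup>2 / \<rho> powr ?p * ?g z)" using g by simp
  then have "integrable lborel (\<lambda>z. ?f (x + \<rho> *\<^sub>R z))" by (simp only: eq)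
  from lborel_integrable_affine[OF _ this, of "1 / \<rho>" "- (1 / \<rho>) *\<^sub>R x"] \<rho>
  have "integrable lborel (\<lambda>y. ?f (x + \<rho> *\<^sub>R (- (1 / \<rho>) *\<^sub>R x + (1 / \<rho>) *\<^sub>R y)))"
    by simp
  moreover have "x + \<rho> *\<^sub>R (- (1 / \<rho>) *\<^sub>R x + (1 / \<rho>) *\<^sub>R y) = y" for y
    using \<rho> by (simp add: scaleR_diff_right)
  ultimately show ?I by (simp only:)
  have "(\<integral>y. ?f y \<partial>lborel) = \<bar>\<rho>\<bar> ^ DIM('a) * (\<integral>z. ?f (x + \<rho> *\<^sub>R z) \<partial>lborel)"
    using \<rho> by (intro lborel_integral_affine) auto
  also have "\<dots> = \<rho> ^ DIM('a) * (\<rho>\<^sup>2 / \<rho> powr ?p) * (\<integral>z. ?g z \<partial>lborel)"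
    unfolding eq using \<rho> by simp
  also have "\<rho> ^ DIM('a) * (\<rho>\<^sup>2 / \<rho> powr ?p) = \<rho> powr (2 - 2 * s)"
  proof -
    have "\<rho> ^ DIM('a) = \<rho> powr real DIM('a)" "\<rho>\<^sup>2 = \<rho> powr 2"
      using \<rho> by (simp_all add: powr_realpow)
    then show ?thesis
      by (simp add: algebra_simps flip: powr_diff powr_add)
  qed
  finally show ?E .
qed

lemma wt_le:
  fixes y z :: "'a::euclidean_space"
  assumes s: "0 < s" and A: "0 \<le> A" and le: "norm z \<le> A * max 1 (norm y)"
  shows "wt s y \<le> (1 + A powr (real DIM('a) + 2 * s)) * wt s z"
proof -
  let ?p = "real DIM('a) + 2 * s"
  have "norm z powr ?p \<le> (A * max 1 (norm y)) powr ?p"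
    using le s by (intro powr_mono2) auto
  also have "\<dots> = A powr ?p * max 1 (norm y) powr ?p"
    using A by (simp add: powr_mult)
  also have "max 1 (norm y) powr ?p \<le> 1 + norm y powr ?p"
    by (simp add: max_def)
  finally have "norm z powr ?p \<le> A powr ?p * (1 + norm y powr ?p)"
    by (simp add: mult_left_mono)
  then have "1 + norm z powr ?p \<le> (1 + A powr ?p) * (1 + norm y powr ?p)"
    using powr_ge_zero[of "norm y" ?p] unfolding distrib_right[of 1] mult_1 by linarith
  moreover have "0 < 1 + norm z powr ?p" "0 < 1 + norm y powr ?p"
    by (simp_all add: add_pos_nonneg)
  ultimately show ?thesis
    by (simp add: wt_def field_simps)
qed

text \<open>Away from its singularity the kernel decays like the weight. This bounds the tail of the
  equation by the weighted integral of \<open>u\<close>; the term with \<epsilon> pays for the 1 in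
  the weight, the term with \<open>B\<close> for the shift between \<open>y\<close> and
  \<open>z\<close>.\<close>

lemma kern_le_wt:
  fixes y z :: "'a::euclidean_space"
  assumes s: "0 < s" and \<epsilon>: "0 < \<epsilon>" "\<epsilon> \<le> norm z" and B: "0 \<le> B" "norm y \<le> B * norm z"
  shows "kern s z \<le> (1 / \<epsilon> powr (real DIM('a) + 2 * s) + B powr (real DIM('a) + 2 * s)) * wt s y"
proof -
  let ?p = "real DIM('a) + 2 * s"
  have "norm y powr ?p \<le> (B * norm z) powr ?p"
    using B s by (intro powr_mono2) auto
  also have "\<dots> = B powr ?p * norm z powr ?p"
    using B by (simp add: powr_mult)
  finally have 1: "norm y powr ?p \<le> B powr ?p * norm z powr ?p" .
  have "\<epsilon> powr ?p \<le> norm z powr ?p"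
    using \<epsilon> s by (intro powr_mono2) auto
  then have "1 \<le> 1 / \<epsilon> powr ?p * norm z powr ?p"
    using \<epsilon> by (simp add: field_simps)
  with 1 have "1 + norm y powr ?p \<le> (1 / \<epsilon> powr ?p + B powr ?p) * norm z powr ?p"
    unfolding distrib_right by linarith
  moreover have "0 < 1 + norm y powr ?p" "0 < norm z powr ?p"
    using \<epsilon> by (auto simp: add_pos_nonneg)
  ultimately show ?thesis
    by (simp add: kern_def wt_def field_simps)
qed

lemma wt_le_one: "wt s y \<le> 1"
  by (simp add: wt_def divide_le_eq add_pos_nonneg)

lemma wt_le_kern: "z \<noteq> 0 \<Longrightarrow> wt s z \<le> kern s z"
  unfolding wt_def kern_def by (intro divide_left_mono) (auto simp: add_pos_nonneg intro!: mult_pos_pos)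

lemma integrable_wt:
  assumes "0 < s"
  shows "integrable lborel (wt s :: 'a::euclidean_space \<Rightarrow> real)"
proof (rule Bochner_Integration.integrable_bound)
  show "integrable lborel (\<lambda>z::'a. indicator (ball 0 1) z + indicator (- ball 0 1) z * kern s z)"
    using integrable_kern_far[OF assms] emeasure_lborel_ball_finite[of "0::'a" 1]
    by (intro Bochner_Integration.integrable_add integrable_real_indicator) auto
  have "wt s z \<le> indicator (ball 0 1) z + indicator (- ball 0 1) z * kern s z" for z :: 'a
  proof (cases "norm z < 1")
    case True
    then show ?thesis using wt_le_one[of s z] by simp
  next
    case False
    moreover from this have "z \<noteq> 0" by auto
    ultimately show ?thesis using wt_le_kern[of z s] by simp
  qed
  then have "norm (wt s z) \<le> norm (indicator (ball 0 1) z + indicator (- ball 0 1) z * kern s z)" for z :: 'a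
    by (metis abs_ge_self abs_of_nonneg order_trans real_norm_def wt_nonneg)
  then show "AE z in lborel. norm (wt s (z::'a)) \<le> norm (indicator (ball 0 1) z + indicator (- ball 0 1) z * kern s z)"
    by (intro always_eventually allI)
qed measurable

section \<open>Pointwise s-harmonic functions\<close>

text \<open>The normalising constant is dropped.\<close>

definition s_harmonic :: "real \<Rightarrow> ('a::euclidean_space \<Rightarrow> real) \<Rightarrow> bool" where
  "s_harmonic s u \<longleftrightarrow> continuous_on UNIV u \<and> integrable lborel (\<lambda>y. u y * wt s y) \<and>
     (\<forall>x. ((\<lambda>\<epsilon>. \<integral>y\<in>(UNIV - ball x \<epsilon>). (u x - u y) * kern s (y - x) \<partial>lborel) \<longlongrightarrow> 0) (at_right 0))"

lemma s_harmonicD: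
  assumes "s_harmonic s u"
  shows "continuous_on UNIV u" "integrable lborel (\<lambda>y. u y * wt s y)"
    "((\<lambda>\<epsilon>. \<integral>y\<in>(UNIV - ball x \<epsilon>). (u x - u y) * kern s (y - x) \<partial>lborel) \<longlongrightarrow> 0) (at_right 0)"
    "u \<in> borel_measurable borel"
  using assms by (auto simp: s_harmonic_def intro: borel_measurable_continuous_onI)

lemma set_integrable_kern:
  fixes u :: "'a::euclidean_space \<Rightarrow> real"
  assumes s: "0 < s" and [measurable]: "u \<in> borel_measurable borel"
    and u: "integrable lborel (\<lambda>y. u y * wt s y)" and \<epsilon>: "0 < \<epsilon>"
  shows "set_integrable lborel (UNIV - ball x \<epsilon>) (\<lambda>y. (u x - u y) * kern s (y - x))"
  unfolding set_integrable_def
proof (rule Bochner_Integration.integrable_bound)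
  let ?p = "real DIM('a) + 2 * s"
  \<comment> \<open>Off the ball, \<open>norm x\<close> is at most
    \<open>norm x / \<epsilon>\<close> times \<open>norm (y - x)\<close>; this gives the factor
    \<open>B = 1 + norm x / \<epsilon>\<close> in \<open>kern_le_wt\<close>.\<close>
  define C where "C = 1 / \<epsilon> powr ?p + (1 + norm x / \<epsilon>) powr ?p"
  have C: "0 \<le> C" by (simp add: C_def)
  show "integrable lborel (\<lambda>y. C * (\<bar>u x\<bar> * wt s y + \<bar>u y * wt s y\<bar>))"
    using integrable_wt[OF s, where 'a='a] u
    by (intro integrable_mult_right Bochner_Integration.integrable_add integrable_abs) auto
  have "\<bar>u x - u y\<bar> * kern s (y - x) \<le> C * (\<bar>u x\<bar> * wt s y + \<bar>u y * wt s y\<bar>)"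
    if y: "\<epsilon> \<le> norm (y - x)" for y
  proof -
    have "norm y \<le> norm (y - x) + norm x"
      using norm_triangle_ineq[of "y - x" x] by simp
    also have "norm x \<le> norm x / \<epsilon> * norm (y - x)"
      using y \<epsilon> mult_left_mono[OF y, of "norm x"] by (simp add: field_simps)
    finally have "norm y \<le> (1 + norm x / \<epsilon>) * norm (y - x)"
      unfolding distrib_right by simp
    then have "kern s (y - x) \<le> C * wt s y"
      unfolding C_def using s \<epsilon> y by (intro kern_le_wt) auto
    then have "\<bar>u x - u y\<bar> * kern s (y - x) \<le> (\<bar>u x\<bar> + \<bar>u y\<bar>) * (C * wt s y)"
      by (intro mult_mono) auto
    then show ?thesis by (simp add: algebra_simps abs_mult)
  qed
  then have "norm (indicator (UNIV - ball x \<epsilon>) y *\<^sub>R ((u x - u y) * kern s (y - x)))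
      \<le> norm (C * (\<bar>u x\<bar> * wt s y + \<bar>u y * wt s y\<bar>))" for y
    using C by (cases "y \<in> ball x \<epsilon>")
      (auto simp: abs_mult dist_norm norm_minus_commute[of x])
  then show "AE y in lborel. norm (indicator (UNIV - ball x \<epsilon>) y *\<^sub>R ((u x - u y) * kern s (y - x)))
      \<le> norm (C * (\<bar>u x\<bar> * wt s y + \<bar>u y * wt s y\<bar>))"
    by simp
qed measurable

lemma s_harmonic_diff_const:
  assumes "0 < s" "s_harmonic s (u :: 'a::euclidean_space \<Rightarrow> real)"
  shows "s_harmonic s (\<lambda>x. u x - c)"
proof -
  have "integrable lborel (\<lambda>y. u y * wt s y - c * wt s y)"
    using s_harmonicD(2)[OF assms(2)] integrable_wt[OF assms(1), where 'a='a]
    by (intro Bochner_Integration.integrable_diff integrable_mult_right) auto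
  then have "integrable lborel (\<lambda>y. (u y - c) * wt s y)"
    by (simp only: left_diff_distrib)
  then show ?thesis
    using assms(2) by (simp add: s_harmonic_def continuous_on_diff)
qed

lemma s_harmonic_minus:
  assumes "s_harmonic s (u :: 'a::euclidean_space \<Rightarrow> real)"
  shows "s_harmonic s (\<lambda>x. - u x)"
proof -
  have "((\<lambda>\<epsilon>. \<integral>y\<in>(UNIV - ball x \<epsilon>). (- u x - - u y) * kern s (y - x) \<partial>lborel) \<longlongrightarrow> 0) (at_right 0)" for x
  proof -
    have "(- u x - - u y) * kern s (y - x) = - ((u x - u y) * kern s (y - x))" for y
      by (simp add: algebra_simps)
    then show ?thesis
      using tendsto_minus[OF s_harmonicD(3)[OF assms, of x]] by (simp add: set_lebesgue_integral_def)
  qed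
  then show ?thesis
    using assms by (auto simp: s_harmonic_def intro!: continuous_intros)
qed

lemma s_harmonic_affine:
  fixes a :: "'a::euclidean_space"
  assumes s: "0 < s" and u: "s_harmonic s u" and R: "0 < R"
  shows "s_harmonic s (\<lambda>z. u (a + R *\<^sub>R z))"
  unfolding s_harmonic_def
proof (intro conjI allI)
  let ?p = "real DIM('a) + 2 * s"
  note [measurable] = s_harmonicD(4)[OF u]
  show "continuous_on UNIV (\<lambda>z. u (a + R *\<^sub>R z))"
    by (rule continuous_on_compose2[OF s_harmonicD(1)[OF u]]) (auto intro!: continuous_intros)
  define C where "C = 1 + (norm a + R) powr ?p"
  have C: "0 \<le> C" by (simp add: C_def)
  show "integrable lborel (\<lambda>z. u (a + R *\<^sub>R z) * wt s z)"
  proof (rule Bochner_Integration.integrable_bound)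
    show "integrable lborel (\<lambda>z. C * (u (a + R *\<^sub>R z) * wt s (a + R *\<^sub>R z)))"
      using lborel_integrable_affine[OF _ s_harmonicD(2)[OF u], of R a] R by simp
    have "wt s z \<le> C * wt s (a + R *\<^sub>R z)" for z
      unfolding C_def
    proof (rule wt_le[OF s])
      have "norm (a + R *\<^sub>R z) \<le> norm a * 1 + R * norm z"
        using norm_triangle_ineq[of a "R *\<^sub>R z"] R by simp
      also have "\<dots> \<le> norm a * max 1 (norm z) + R * max 1 (norm z)"
        using R by (intro add_mono mult_left_mono) auto
      finally show "norm (a + R *\<^sub>R z) \<le> (norm a + R) * max 1 (norm z)"
        by (simp add: distrib_right)
    qed (use R in auto)
    then have "\<bar>u (a + R *\<^sub>R z)\<bar> * wt s z \<le> \<bar>u (a + R *\<^sub>R z)\<bar> * (C * wt s (a + R *\<^sub>R z))" for z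
      by (intro mult_left_mono) auto
    then show "AE z in lborel. norm (u (a + R *\<^sub>R z) * wt s z)
        \<le> norm (C * (u (a + R *\<^sub>R z) * wt s (a + R *\<^sub>R z)))"
      using C by (simp add: abs_mult mult_ac)
  qed measurable
  fix x
  \<comment> \<open>\<open>D\<close> equals R^(2s), the factor by which an operator of order 2s
    scales. Only its independence of \<epsilon> matters, since the limit is 0.\<close>
  define D where "D = R powr ?p / R ^ DIM('a)"
  let ?F = "\<lambda>\<epsilon>. \<integral>y\<in>(UNIV - ball (a + R *\<^sub>R x) \<epsilon>). (u (a + R *\<^sub>R x) - u y) * kern s (y - (a + R *\<^sub>R x)) \<partial>lborel"
  have "(\<integral>z\<in>(UNIV - ball x \<epsilon>). (u (a + R *\<^sub>R x) - u (a + R *\<^sub>R z)) * kern s (z - x) \<partial>lborel)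
      = D * ?F (R * \<epsilon>)" for \<epsilon>
  proof -
    let ?g = "\<lambda>y. indicator (UNIV - ball (a + R *\<^sub>R x) (R * \<epsilon>)) y *\<^sub>R
      ((u (a + R *\<^sub>R x) - u y) * kern s (y - (a + R *\<^sub>R x)))"
    have eq: "R powr ?p * ?g (a + R *\<^sub>R z) = indicator (UNIV - ball x \<epsilon>) z *\<^sub>R
        ((u (a + R *\<^sub>R x) - u (a + R *\<^sub>R z)) * kern s (z - x))" for z
    proof -
      have 1: "a + R *\<^sub>R z - (a + R *\<^sub>R x) = R *\<^sub>R (z - x)"
        by (simp add: scaleR_diff_right)
      have "dist (a + R *\<^sub>R x) (a + R *\<^sub>R z) = R * dist x z"
        using R by (simp add: dist_norm flip: scaleR_diff_right)
      then have "a + R *\<^sub>R z \<in> ball (a + R *\<^sub>R x) (R * \<epsilon>) \<longleftrightarrow> z \<in> ball x \<epsilon>"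
        using R by simp
      then show ?thesis
        unfolding 1 using R by (auto simp: indicator_def kern_scaleR)
    qed
    have "?F (R * \<epsilon>) = \<bar>R\<bar> ^ DIM('a) * (\<integral>z. ?g (a + R *\<^sub>R z) \<partial>lborel)"
      unfolding set_lebesgue_integral_def using R by (intro lborel_integral_affine) auto
    then have "D * ?F (R * \<epsilon>) = R powr ?p * (\<integral>z. ?g (a + R *\<^sub>R z) \<partial>lborel)"
      using R by (simp add: D_def)
    also have "\<dots> = (\<integral>z. R powr ?p * ?g (a + R *\<^sub>R z) \<partial>lborel)"
      by (rule integral_mult_right_zero[symmetric])
    finally show ?thesis
      unfolding eq set_lebesgue_integral_def by simp
  qed
  moreover have "filterlim (\<lambda>\<epsilon>. R * \<epsilon>) (at_right 0) (at_right 0)"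
    using R by (auto simp: filterlim_at eventually_at_right_field intro!: tendsto_eq_intros exI[of _ 1])
  then have "((\<lambda>\<epsilon>. D * ?F (R * \<epsilon>)) \<longlongrightarrow> D * 0) (at_right 0)"
    by (intro tendsto_mult tendsto_const filterlim_compose[OF s_harmonicD(3)[OF u]])
  ultimately show "((\<lambda>\<epsilon>. \<integral>z\<in>(UNIV - ball x \<epsilon>). (u (a + R *\<^sub>R x) - u (a + R *\<^sub>R z)) * kern s (z - x) \<partial>lborel)
      \<longlongrightarrow> 0) (at_right 0)"
    by simp
qed

section \<open>Harnack inequality\<close>

lemma integrable_indicator_ball: "integrable lborel (indicator (ball (a::'a::euclidean_space) r) :: 'a \<Rightarrow> real)"
  using emeasure_lborel_ball_finite[of a r] by (intro integrable_real_indicator) auto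

lemma
  fixes x :: "'a::euclidean_space"
  assumes s: "0 < s"
  shows integrable_kern_far_at: "integrable lborel (\<lambda>y. indicator (- ball x 1) y * kern s (y - x))"
    and integral_kern_far_at: "(\<integral>y. indicator (- ball x 1) y * kern s (y - x) \<partial>lborel)
      = (\<integral>z. indicator (- ball 0 1) (z::'a) * kern s z \<partial>lborel)"
proof -
  have [measurable]: "(\<lambda>z::'a. indicator (- ball 0 1) z * kern s z) \<in> borel_measurable borel"
    using integrable_kern_far[OF s, where 'a='a] by (simp add: borel_measurable_integrable)
  have *: "indicator (- ball 0 1) (- x + y) * kern s (- x + y) = indicator (- ball x 1) y * kern s (y - x)" for y
    by (auto simp: indicator_def dist_norm norm_minus_commute)
  show "integrable lborel (\<lambda>y. indicator (- ball x 1) y * kern s (y - x))"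
    using lborel_integrable_affine[OF _ integrable_kern_far[OF s], of 1 "- x"] unfolding scaleR_one * by simp
  show "(\<integral>y. indicator (- ball x 1) y * kern s (y - x) \<partial>lborel)
      = (\<integral>z. indicator (- ball 0 1) (z::'a) * kern s z \<partial>lborel)"
    using lborel_integral_affine[of 1 "\<lambda>z. indicator (- ball 0 1) z * kern s z" "- x"]
    unfolding scaleR_one * by simp
qed

lemma weak_Harnack:
  assumes s: "0 < s" "s < 1"
  shows "\<exists>C\<ge>0. \<forall>u::'a::euclidean_space \<Rightarrow> real. s_harmonic s u \<longrightarrow> (\<forall>x. 0 \<le> u x) \<longrightarrow>
    (\<forall>x. norm x \<le> 1 \<longrightarrow> (\<integral>y. u y * wt s y \<partial>lborel) \<le> C * u x)"
proof -
  let ?p = "real DIM('a) + 2 * s"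
  define c1 where "c1 = (\<integral>z. indicator (ball 0 1) (z::'a) * ((norm z)\<^sup>2 * kern s z) \<partial>lborel)"
  define c2 where "c2 = (\<integral>z. indicator (- ball 0 1) (z::'a) * kern s z \<partial>lborel)"
  define \<omega> where "\<omega> = unit_ball_vol (real DIM('a))"
  \<comment> \<open>As \<open>x0\<close> will have norm at most 2, \<open>norm (y - x0)\<close> is
    at most \<open>3 * max 1 (norm y)\<close>. Hence \<open>q\<close> times the weight at
    \<open>y\<close> lies below the kernel at \<open>y - x0\<close> outside the unit ball about
    \<open>x0\<close>.\<close>
  define q where "q = 1 / (1 + 3 powr ?p)"
  have q: "0 < q" "q \<le> 1"
    by (simp_all add: q_def add_pos_nonneg divide_le_eq)
  have c: "0 \<le> c1" "0 \<le> c2" "0 \<le> \<omega>"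
    by (auto simp: c1_def c2_def \<omega>_def intro!: Bochner_Integration.integral_nonneg)
  define C where "C = (c1 + 6 * \<omega> + 2 * c2) / q"
  have "(\<integral>y. u y * wt s y \<partial>lborel) \<le> C * u x1"
    if u: "s_harmonic s u" and nonneg: "\<And>x. 0 \<le> u x" and x1: "norm x1 \<le> 1" for u :: "'a \<Rightarrow> real" and x1
  proof -
    define I where "I = (\<integral>y. u y * wt s y \<partial>lborel)"
    \<comment> \<open>A strict inequality keeps the paraboloid nondegenerate even if
      \<open>u x1 = 0\<close>; letting \<open>T\<close> decrease to \<open>u x1\<close> recovers the
      claim.\<close>
    have key: "I \<le> C * T" if T: "u x1 < T" for T
    proof -
      have T0: "0 < T" using T nonneg[of x1] by linarith
      define f where "f x = u x + T * (norm x)\<^sup>2" for x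
      have "continuous_on (cball 0 2) f"
        unfolding f_def using s_harmonicD(1)[OF u]
        by (intro continuous_intros) (auto intro: continuous_on_subset)
      then obtain x0 where x0: "x0 \<in> cball 0 2" "\<And>y. y \<in> cball 0 2 \<Longrightarrow> f x0 \<le> f y"
        using continuous_attains_inf[of "cball (0::'a) 2" f] by auto
      have "(norm x1)\<^sup>2 \<le> 1" using x1 by (simp add: power_le_one)
      then have "T * (norm x1)\<^sup>2 \<le> T" using T0 by simp
      then have "f x1 \<le> 2 * T" using T by (simp add: f_def)
      moreover have "f x0 \<le> f x1" using x0(2)[of x1] x1 by simp
      ultimately have fx0: "f x0 \<le> 2 * T" by simp
      \<comment> \<open>Radius 2 makes the minimum global: outside, the quadratic term alone exceeds
        4T, while the minimum is at most 2T.\<close>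
      have min: "f x0 \<le> f y" for y
      proof (cases "norm y \<le> 2")
        case False
        then have "2\<^sup>2 \<le> (norm y)\<^sup>2" by (intro power_mono) auto
        then have "T * 4 \<le> T * (norm y)\<^sup>2" using T0 by (intro mult_left_mono) auto
        then show ?thesis using fx0 nonneg[of y] T0 unfolding f_def[of y] by linarith
      qed (use x0 in auto)
      have "0 \<le> T * (norm x0)\<^sup>2" using T0 by simp
      then have ux0: "u x0 \<le> 2 * T"
        using fx0 unfolding f_def by linarith
      \<comment> \<open>The positive terms are the curvature of the paraboloid and its height inside
        the unit ball about \<open>x0\<close>, and the bound 2T on \<open>u x0\<close> outside. The
        negative term retains a fixed share of the weighted mass of \<open>u\<close> everywhere,
        which the sign of the integral then bounds.\<close>
      define H where "H y = T * (indicator (ball x0 1) y * ((norm (y - x0))\<^sup>2 * kern s (y - x0)))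
        + 6 * T * indicator (ball x0 1) y + 2 * T * (indicator (- ball x0 1) y * kern s (y - x0))
        - q * (u y * wt s y)" for y
      note ints = integral_kern_near_scaled(1)[OF s, of 1 x0] integrable_indicator_ball[of x0 1]
        integrable_kern_far_at[OF s(1), of x0] s_harmonicD(2)[OF u]
      have "0 \<le> (\<integral>y. H y \<partial>lborel)"
      proof (rule pv_upper[OF s(1) _ set_integrable_kern[OF s(1) s_harmonicD(4)[OF u] s_harmonicD(2)[OF u]] s_harmonicD(3)[OF u]])
        show "integrable lborel H"
          unfolding H_def using ints
          by (intro Bochner_Integration.integrable_diff Bochner_Integration.integrable_add integrable_mult_right) auto
        fix y :: 'a
        assume y: "y \<noteq> x0"
        define z where "z = y - x0"
        let ?K = "kern s z"
        have z: "z \<noteq> 0" using y by (simp add: z_def)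
        have K: "0 \<le> ?K" by simp
        show "(u x0 - u y) * kern s (y - x0) \<le>
          indicator (ball x0 1) y * (((2 * T) *\<^sub>R x0) \<bullet> (y - x0) * kern s (y - x0)) + H y"
        proof (cases "norm z < 1")
          case True
          txt \<open>Here the kernel exceeds 1, so the gap between \<open>u\<close> and the paraboloid \<open>l\<close> controls \<open>u\<close> itself.\<close>
          define l where "l = u x0 - T * (2 * (x0 \<bullet> z) + (norm z)\<^sup>2)"
          have "(norm y)\<^sup>2 = (norm x0)\<^sup>2 + 2 * (x0 \<bullet> z) + (norm z)\<^sup>2"
            unfolding z_def power2_norm_eq_inner by (simp add: inner_diff inner_commute algebra_simps)
          then have l_le: "l \<le> u y"
            using min[of y] unfolding f_def l_def by (simp add: algebra_simps)
          have "\<bar>x0 \<bullet> z\<bar> \<le> norm x0 * norm z" by (rule Cauchy_Schwarz_ineq2)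
          also have "\<dots> \<le> 2 * 1" using True x0(1) by (intro mult_mono) auto
          finally have "T * (- 4) \<le> T * (2 * (x0 \<bullet> z) + (norm z)\<^sup>2)"
            using T0 zero_le_power2[of "norm z"] by (intro mult_left_mono) linarith+
          \<comment> \<open>Of the 6T, 2T bounds \<open>u x0\<close> and 4T bounds the slope term,
            as \<open>norm x0\<close> is at most 2 and \<open>norm z\<close> below 1.\<close>
          then have l6: "l \<le> 6 * T" using ux0 unfolding l_def by linarith
          have "1 \<le> ?K" using kern_ge[of s z 1] s z True by simp
          then have "u y - l \<le> (u y - l) * ?K"
            using l_le mult_left_mono[of 1 ?K "u y - l"] by simp
          moreover have "q * (u y * wt s y) \<le> 1 * (u y * 1)"
            using q nonneg[of y] wt_le_one[of s y] by (intro mult_mono) auto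
          ultimately have "(u x0 - l) * ?K - (u y - l) * ?K \<le> (u x0 - l) * ?K + 6 * T - q * (u y * wt s y)"
            using l6 by linarith
          moreover have "(u x0 - l) * ?K = (2 * T) * (x0 \<bullet> z) * ?K + T * ((norm z)\<^sup>2 * ?K)"
            unfolding l_def by (simp add: algebra_simps)
          moreover have "(u x0 - u y) * ?K = (u x0 - l) * ?K - (u y - l) * ?K"
            by (simp add: algebra_simps)
          moreover have "y \<in> ball x0 1"
            using True by (simp add: z_def dist_norm norm_minus_commute)
          ultimately show ?thesis
            unfolding H_def z_def[symmetric] by simp
        next
          case False
          have "norm z \<le> norm y + norm x0" unfolding z_def by (rule norm_triangle_ineq4)
          also have "\<dots> \<le> 3 * max 1 (norm y)" using x0(1) by (simp add: max_def)
          finally have "wt s y \<le> (1 + 3 powr ?p) * wt s z"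
            using s by (intro wt_le) auto
          also have "\<dots> \<le> (1 + 3 powr ?p) * ?K"
            using wt_le_kern[OF z] by (intro mult_left_mono) (auto simp: add_nonneg_nonneg)
          finally have "q * wt s y \<le> ?K"
            by (simp add: q_def field_simps add_pos_nonneg)
          then have "u y * (q * wt s y) \<le> u y * ?K"
            using nonneg by (intro mult_left_mono) auto
          moreover have "u x0 * ?K \<le> 2 * T * ?K"
            using ux0 by (intro mult_right_mono) auto
          moreover have "y \<notin> ball x0 1"
            using False by (simp add: z_def dist_norm norm_minus_commute)
          ultimately show ?thesis
            unfolding H_def z_def[symmetric] by (simp add: algebra_simps)
        qed
      qed auto
      also have "(\<integral>y. H y \<partial>lborel) = T * c1 + 6 * T * \<omega> + 2 * T * c2 - q * I"
        unfolding H_def I_def using ints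
        by (simp add: Bochner_Integration.integral_diff Bochner_Integration.integral_add
            integral_kern_near_scaled(2)[OF s] integral_kern_far_at[OF s(1)] c1_def c2_def \<omega>_def content_ball)
      finally have "I * q \<le> (c1 + 6 * \<omega> + 2 * c2) * T"
        by (simp add: algebra_simps)
      then show ?thesis
        using q by (simp add: C_def field_simps)
    qed
    have "((\<lambda>T. C * T) \<longlongrightarrow> C * u x1) (at_right (u x1))"
      by (intro tendsto_intros)
    then have "I \<le> C * u x1"
      using key by (intro tendsto_lowerbound[of "\<lambda>T. C * T"])
        (auto simp: eventually_at_right_field intro!: exI[of _ "u x1 + 1"])
    then show ?thesis by (simp add: I_def)
  qed
  moreover have "0 \<le> C" using c q by (simp add: C_def)
  ultimately show ?thesis by blast
qed

section \<open>Upper bound at the centre by means of the barrier\<close>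

text \<open>A second-order Taylor bound for the barrier, obtained by multiplying in one factor at a
  time instead of differentiating. Staying within 1/2 of the origin keeps each factor at most
  2.\<close>

lemma inverse_power_quadratic_bound:
  "\<exists>C\<ge>0. \<forall>\<theta>::real. \<bar>\<theta>\<bar> \<le> 1 / 2 \<longrightarrow> 1 / (1 - \<theta>) ^ N \<le> 1 + real N * \<theta> + C * \<theta>\<^sup>2"
proof (induction N)
  case 0
  then show ?case by (auto intro: exI[of _ 0])
next
  case (Suc N)
  then obtain C where C: "0 \<le> C" "\<And>\<theta>::real. \<bar>\<theta>\<bar> \<le> 1 / 2 \<Longrightarrow> 1 / (1 - \<theta>) ^ N \<le> 1 + real N * \<theta> + C * \<theta>\<^sup>2"
    by blast
  have "1 / (1 - \<theta>) ^ Suc N \<le> 1 + real (Suc N) * \<theta> + (2 + 2 * real N + 2 * C) * \<theta>\<^sup>2"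
    if \<theta>: "\<bar>\<theta>\<bar> \<le> 1 / 2" for \<theta> :: real
  proof -
    have pos: "1 / 2 \<le> 1 - \<theta>" using \<theta> by linarith
    have "1 / (1 - \<theta>) ^ Suc N = 1 / (1 - \<theta>) ^ N * (1 / (1 - \<theta>))" by simp
    also have "\<dots> \<le> (1 + real N * \<theta> + C * \<theta>\<^sup>2) * (1 / (1 - \<theta>))"
      using C(2)[OF \<theta>] pos by (intro mult_right_mono) auto
    also have "\<dots> = 1 + real (Suc N) * \<theta> + (1 + real N + C) * \<theta>\<^sup>2 * (1 / (1 - \<theta>))"
      using pos by (simp add: field_simps power2_eq_square)
    also have "1 / (1 - \<theta>) \<le> 2" using pos by (simp add: field_simps)
    then have "(1 + real N + C) * \<theta>\<^sup>2 * (1 / (1 - \<theta>)) \<le> (1 + real N + C) * \<theta>\<^sup>2 * 2"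
      using C(1) by (intro mult_left_mono) auto
    finally show ?thesis by (simp add: algebra_simps)
  qed
  moreover have "0 \<le> 2 + 2 * real N + 2 * C" using C(1) by simp
  ultimately show ?case by blast
qed

lemma local_boundedness:
  assumes s: "0 < s" "s < 1"
  shows "\<exists>C\<ge>0. \<forall>u::'a::euclidean_space \<Rightarrow> real. s_harmonic s u \<longrightarrow> (\<forall>x. 0 \<le> u x) \<longrightarrow>
    u 0 \<le> C * (\<integral>y. u y * wt s y \<partial>lborel)"
proof -
  let ?p = "real DIM('a) + 2 * s"
  let ?n = "DIM('a)"
  have n: "1 \<le> real ?n" using DIM_positive[where 'a='a] by linarith
  define c1 where "c1 = (\<integral>z. indicator (ball 0 1) (z::'a) * ((norm z)\<^sup>2 * kern s z) \<partial>lborel)"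
  define \<omega> where "\<omega> = unit_ball_vol (real ?n)"
  have c: "0 \<le> c1" "0 < \<omega>"
    by (auto simp: c1_def \<omega>_def intro!: Bochner_Integration.integral_nonneg)
  obtain C1 where C1: "0 \<le> C1"
    "\<And>\<theta>::real. \<bar>\<theta>\<bar> \<le> 1 / 2 \<Longrightarrow> 1 / (1 - \<theta>) ^ ?n \<le> 1 + real ?n * \<theta> + C1 * \<theta>\<^sup>2"
    using inverse_power_quadratic_bound[of ?n] by blast
  \<comment> \<open>This bounds the second-order part of the barrier in units of M/d^2:
    \<open>real ?n\<close> comes from the square inside \<theta>, where d \<le> 1 allows d^2 in
    place of d, and 9 from |\<theta>| \<le> 3|z|/d.\<close>
  define C2 where "C2 = real ?n + 9 * C1"
  have C2: "0 \<le> C2" using C1 by (simp add: C2_def)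
  \<comment> \<open>The first bound limits the slope of the barrier to a change of M/4 over the ball
    and keeps |\<theta>| below 1/2. The second makes the curvature cost at most half the gain; the
    added 1 keeps the denominator positive.\<close>
  define r where "r = min (1 / (8 * real ?n)) (\<omega> / (8 * (C2 * c1 + 1)))"
  have den: "0 < C2 * c1 + 1" using C2 c by (simp add: add_nonneg_pos)
  have r0: "0 < r" using den c n by (simp add: r_def)
  have "r \<le> 1 / (8 * real ?n)" by (simp add: r_def)
  then have r1: "2 * real ?n * r \<le> 1 / 4" using n by (simp add: field_simps)
  have "1 * r \<le> real ?n * r" using n r0 by (intro mult_right_mono) auto
  then have r2: "r \<le> 1 / 8" using r1 by simp
  have "r \<le> \<omega> / (8 * (C2 * c1 + 1))" by (simp add: r_def)
  then have "r * (C2 * c1 + 1) \<le> \<omega> / 8" using den by (simp add: field_simps)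
  moreover have "r\<^sup>2 * (C2 * c1) \<le> r * (C2 * c1 + 1)"
  proof (rule mult_mono)
    show "r\<^sup>2 \<le> r" using r0 r2 by (simp add: power2_eq_square mult_le_one)
  qed (use r0 C2 c in auto)
  ultimately have r3: "C2 * c1 * r\<^sup>2 \<le> \<omega> / 8" by (simp add: mult.commute)
  define C where "C = 8 * (1 + 2 powr ?p) / (\<omega> * r ^ ?n)"
  have C0: "0 \<le> C" using c r0 by (simp add: C_def add_nonneg_nonneg)
  have "u 0 \<le> C * (\<integral>y. u y * wt s y \<partial>lborel)"
    if u: "s_harmonic s u" and nonneg: "\<And>x. 0 \<le> u x" for u :: "'a \<Rightarrow> real"
  proof -
    define I where "I = (\<integral>y. u y * wt s y \<partial>lborel)"
    have I0: "0 \<le> I" unfolding I_def using nonneg by (intro Bochner_Integration.integral_nonneg) auto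
    \<comment> \<open>The quotient of \<open>u\<close> by the barrier is maximised in product form,
      which extends continuously to the sphere, where the barrier is infinite. Its maximum
      \<open>t\<close> is the least multiple of the barrier lying above \<open>u\<close>.\<close>
    have "continuous_on (cball 0 1) (\<lambda>x. u x * (1 - (norm x)\<^sup>2) ^ ?n)"
      using s_harmonicD(1)[OF u]
      by (intro continuous_intros) (auto intro: continuous_on_subset)
    then obtain x0 where x0: "x0 \<in> cball 0 1"
      and max: "\<And>y. y \<in> cball 0 1 \<Longrightarrow> u y * (1 - (norm y)\<^sup>2) ^ ?n \<le> u x0 * (1 - (norm x0)\<^sup>2) ^ ?n"
      using continuous_attains_sup[of "cball (0::'a) 1" "\<lambda>x. u x * (1 - (norm x)\<^sup>2) ^ ?n"] by auto
    define d where "d = 1 - (norm x0)\<^sup>2"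
    define M where "M = u x0"
    define t where "t = M * d ^ ?n"
    have t: "u 0 \<le> t" using max[of 0] by (simp add: t_def M_def d_def)
    show ?thesis
    proof (cases "t = 0")
      case True
      then show ?thesis using t I0 C0 mult_nonneg_nonneg[OF C0 I0] unfolding I_def by linarith
    next
      case False
      have nx0: "norm x0 \<le> 1" using x0 by simp
      then have "(norm x0)\<^sup>2 \<le> 1" by (simp add: power_le_one)
      moreover have "d \<noteq> 0" using False by (auto simp: t_def zero_power)
      ultimately have d: "0 < d" "d \<le> 1" by (auto simp: d_def)
      have M: "0 < M" using False nonneg[of x0] by (cases "M = 0") (auto simp: t_def M_def)
      define \<rho> where "\<rho> = r * d"
      have \<rho>: "0 < \<rho>" "\<rho> \<le> d / 8" using r0 r2 d by (simp_all add: \<rho>_def)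
      then have \<rho>1: "\<rho> \<le> 1" using d by simp
      define E where "E = \<rho> powr ?p"
      have E: "0 < E" using \<rho> by (simp add: E_def)
      \<comment> \<open>\<open>Q\<close> equals \<open>1 / E + (2 / \<rho>) powr ?p\<close>, the
        constant that \<open>kern_le_wt\<close> yields off the ball of radius \<rho>; it also
        dominates \<open>1 / E\<close>, as needed inside.\<close>
      define Q where "Q = (1 + 2 powr ?p) / E"
      have Q: "0 < Q" "1 / E \<le> Q" using E by (simp_all add: Q_def add_pos_nonneg divide_right_mono)
      define H where "H y = M / 4 / E * indicator (ball x0 \<rho>) y
        - M * C2 / d\<^sup>2 * (indicator (ball x0 \<rho>) y * ((norm (y - x0))\<^sup>2 * kern s (y - x0)))
        - Q * (u y * wt s y)" for y
      \<comment> \<open>Minus the gradient at \<open>x0\<close> of the barrier of height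
        \<open>M\<close> there.\<close>
      define b where "b = (- (M * (2 * real ?n / d))) *\<^sub>R x0"
      note ints = integral_kern_near_scaled(1)[OF s \<rho>(1), of x0] integrable_indicator_ball[of x0 \<rho>]
        s_harmonicD(2)[OF u]
      have E\<rho>: "E * \<rho> powr (2 - 2 * s) = \<rho> ^ ?n * \<rho>\<^sup>2"
      proof -
        have "E * \<rho> powr (2 - 2 * s) = \<rho> powr (real (?n + 2))"
          unfolding E_def by (simp add: add.commute flip: powr_add)
        also have "\<dots> = \<rho> ^ (?n + 2)" using \<rho> by (simp only: powr_realpow)
        finally show ?thesis by (simp only: power_add)
      qed
      have E_term: "E * (M * C2 / d\<^sup>2 * (\<rho> powr (2 - 2 * s) * c1)) = M * \<rho> ^ ?n * (C2 * c1 * r\<^sup>2)"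
      proof -
        have "E * (M * C2 / d\<^sup>2 * (\<rho> powr (2 - 2 * s) * c1)) = M * C2 / d\<^sup>2 * c1 * (E * \<rho> powr (2 - 2 * s))"
          by (simp add: mult_ac)
        also have "\<dots> = M * \<rho> ^ ?n * (C2 * c1 * (\<rho>\<^sup>2 / d\<^sup>2))" unfolding E\<rho> by (simp add: mult_ac)
        also have "\<rho>\<^sup>2 / d\<^sup>2 = r\<^sup>2" using d by (simp add: \<rho>_def power_mult_distrib)
        finally show ?thesis .
      qed
      have "(\<integral>y. H y \<partial>lborel) \<le> 0"
      proof (rule pv_lower[OF s(1) \<rho>(1) set_integrable_kern[OF s(1) s_harmonicD(4)[OF u] s_harmonicD(2)[OF u]] s_harmonicD(3)[OF u]])
        show "integrable lborel H"
          unfolding H_def using ints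
          by (intro Bochner_Integration.integrable_diff Bochner_Integration.integrable_add integrable_mult_right) auto
        fix y :: 'a
        assume y: "y \<noteq> x0"
        define z where "z = y - x0"
        let ?K = "kern s z"
        have z: "z \<noteq> 0" using y by (simp add: z_def)
        have uw: "0 \<le> Q * (u y * wt s y)" using Q nonneg[of y] by simp
        show "indicator (ball x0 \<rho>) y * ((b \<bullet> (y - x0)) * kern s (y - x0)) + H y \<le> (u x0 - u y) * kern s (y - x0)"
        proof (cases "norm z < \<rho>")
          case True
          then have z1: "norm z \<le> 1" using \<rho>1 by simp
          \<comment> \<open>Chosen so that 1 - |y|^2 = d (1 - \<theta>); the barrier at
            \<open>y\<close> is then M (1 - \<theta>)^(-n).\<close>
          define \<theta> where "\<theta> = (2 * (x0 \<bullet> z) + (norm z)\<^sup>2) / d"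
          have "\<bar>x0 \<bullet> z\<bar> \<le> norm x0 * norm z" by (rule Cauchy_Schwarz_ineq2)
          also have "\<dots> \<le> 1 * norm z" using nx0 by (intro mult_right_mono) auto
          finally have x0z: "\<bar>x0 \<bullet> z\<bar> \<le> norm z" by simp
          have zz: "(norm z)\<^sup>2 \<le> norm z" using z1 by (simp add: power2_eq_square mult_left_le_one_le)
          have "\<bar>2 * (x0 \<bullet> z) + (norm z)\<^sup>2\<bar> \<le> 3 * norm z" using x0z zz zero_le_power2[of "norm z"] by linarith
          then have \<theta>: "\<bar>\<theta>\<bar> \<le> 3 * norm z / d"
            using d by (simp add: \<theta>_def divide_right_mono)
          have "3 * norm z / d \<le> 3 / 8" using True \<rho>(2) d by (simp add: field_simps)
          then have \<theta>_half: "\<bar>\<theta>\<bar> \<le> 1 / 2" using \<theta> by linarith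
          have "\<theta>\<^sup>2 \<le> (3 * norm z / d)\<^sup>2" using power_mono[OF \<theta> abs_ge_zero, of 2] by simp
          then have "C1 * \<theta>\<^sup>2 \<le> C1 * (3 * norm z / d)\<^sup>2"
            using C1 by (intro mult_left_mono)
          then have \<theta>2: "C1 * \<theta>\<^sup>2 \<le> 9 * C1 * ((norm z)\<^sup>2 / d\<^sup>2)"
            by (simp add: power_divide power_mult_distrib mult_ac)
          have "d * d \<le> d * 1" using d by (intro mult_left_mono) auto
          then have "(norm z)\<^sup>2 / d \<le> (norm z)\<^sup>2 / d\<^sup>2"
            using d by (intro divide_left_mono) (auto simp: power2_eq_square)
          then have n\<theta>: "real ?n * \<theta> \<le> real ?n * (2 * (x0 \<bullet> z) / d) + real ?n * ((norm z)\<^sup>2 / d\<^sup>2)"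
            unfolding distrib_left[symmetric] \<theta>_def add_divide_distrib
            by (intro mult_left_mono add_left_mono) auto
          have ny: "1 - (norm y)\<^sup>2 = d * (1 - \<theta>)"
          proof -
            have "(norm y)\<^sup>2 = (norm x0)\<^sup>2 + 2 * (x0 \<bullet> z) + (norm z)\<^sup>2"
              unfolding z_def power2_norm_eq_inner by (simp add: inner_diff inner_commute algebra_simps)
            then show ?thesis using d by (simp add: d_def \<theta>_def field_simps)
          qed
          have \<theta>pos: "0 < 1 - \<theta>" using \<theta>_half by linarith
          have "0 < 1 - (norm y)\<^sup>2" unfolding ny using d \<theta>pos by simp
          then have ny1: "norm y < 1" using abs_square_less_1[of "norm y"] by simp
          then have "u y * (d ^ ?n * (1 - \<theta>) ^ ?n) \<le> M * d ^ ?n"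
            using max[of y] unfolding ny M_def d_def[symmetric] by (simp add: power_mult_distrib)
          then have "u y \<le> M * (1 / (1 - \<theta>) ^ ?n)"
            using d \<theta>pos by (simp add: field_simps)
          also have "\<dots> \<le> M * (1 + real ?n * \<theta> + C1 * \<theta>\<^sup>2)"
            using M C1(2)[OF \<theta>_half] by (intro mult_left_mono) auto
          also have "\<dots> \<le> M * (1 + real ?n * (2 * (x0 \<bullet> z) / d) + C2 * ((norm z)\<^sup>2 / d\<^sup>2))"
            using n\<theta> \<theta>2 M unfolding C2_def distrib_right by (intro mult_left_mono) linarith+
          also have "\<dots> = M - b \<bullet> z + M * C2 / d\<^sup>2 * (norm z)\<^sup>2"
            by (simp add: b_def algebra_simps)
          finally have L: "b \<bullet> z - M * C2 / d\<^sup>2 * (norm z)\<^sup>2 \<le> M - u y" by simp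
          have K: "1 / E \<le> ?K" unfolding E_def using True s z by (intro kern_ge) auto
          have goal: "(b \<bullet> z - M * C2 / d\<^sup>2 * (norm z)\<^sup>2) * ?K + M / 4 / E - Q * (u y * wt s y) \<le> (M - u y) * ?K"
          \<comment> \<open>This dichotomy replaces a measure estimate of the set where
            \<open>u\<close> is large. Below M/2 the difference M - u(y) is at least M/2, and the
            slope uses up at most half of it, leaving M/4. Otherwise the weighted mass term of
            \<open>H\<close> cancels the claimed gain, and touching alone suffices.\<close>
          proof (cases "u y < M / 2")
            case True
            have "\<bar>b \<bullet> z\<bar> = M * (2 * real ?n / d) * \<bar>x0 \<bullet> z\<bar>"
              using M d by (simp add: b_def abs_mult)
            also have "\<dots> \<le> M * (2 * real ?n / d) * (r * d)"
              using x0z \<open>norm z < \<rho>\<close> M d unfolding \<rho>_def by (intro mult_left_mono) auto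
            also have "\<dots> = M * (2 * real ?n * r)" using d by simp
            also have "\<dots> \<le> M * (1 / 4)" using r1 M by (intro mult_left_mono) auto
            finally have "b \<bullet> z \<le> M / 4" by simp
            moreover have "0 \<le> M * C2 / d\<^sup>2 * (norm z)\<^sup>2" using M C2 by simp
            ultimately have "b \<bullet> z - M * C2 / d\<^sup>2 * (norm z)\<^sup>2 + M / 4 \<le> M - u y"
              using True by linarith
            then have "(b \<bullet> z - M * C2 / d\<^sup>2 * (norm z)\<^sup>2 + M / 4) * ?K \<le> (M - u y) * ?K"
              by (intro mult_right_mono) auto
            moreover have "M / 4 * (1 / E) \<le> M / 4 * ?K" using K M by (intro mult_left_mono) auto
            ultimately show ?thesis using uw by (simp add: distrib_right)
          next
            case False
            have "norm y powr ?p \<le> 1"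
              using ny1 s powr_mono2[of ?p "norm y" 1] by simp
            then have "1 / 2 \<le> wt s y" by (simp add: wt_def field_simps add_pos_nonneg)
            then have "M / 2 * (1 / 2) \<le> u y * wt s y" using False M by (intro mult_mono) auto
            then have "1 / E * (M / 2 * (1 / 2)) \<le> Q * (u y * wt s y)"
              using M Q E by - (rule mult_mono, auto)
            moreover have "(b \<bullet> z - M * C2 / d\<^sup>2 * (norm z)\<^sup>2) * ?K \<le> (M - u y) * ?K"
              using L by (intro mult_right_mono) auto
            ultimately show ?thesis by simp
          qed
          have "y \<in> ball x0 \<rho>"
            using True by (simp add: z_def dist_norm norm_minus_commute)
          then show ?thesis
            using goal unfolding H_def z_def[symmetric] M_def[symmetric] by (simp add: algebra_simps)
        next
          case False
          then have \<rho>z: "\<rho> \<le> norm z" by simp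
          have "norm y \<le> norm z + norm x0" unfolding z_def using norm_triangle_ineq[of "y - x0" x0] by simp
          also have "\<dots> \<le> norm z * (1 / \<rho>) + norm z * (1 / \<rho>)"
          proof (intro add_mono)
            show "norm z \<le> norm z * (1 / \<rho>)"
              using \<rho> \<rho>1 mult_left_mono[of 1 "1 / \<rho>" "norm z"] by simp
            show "norm x0 \<le> norm z * (1 / \<rho>)"
              using \<rho> \<rho>z nx0 by (intro order_trans[OF nx0]) simp
          qed
          finally have "?K \<le> (1 / E + (2 / \<rho>) powr ?p) * wt s y"
            unfolding E_def using \<rho> \<rho>z s by (intro kern_le_wt) auto
          also have "1 / E + (2 / \<rho>) powr ?p = Q"
            using \<rho> by (simp add: Q_def E_def powr_divide add_divide_distrib)
          finally have "u y * ?K \<le> u y * (Q * wt s y)"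
            using nonneg by (intro mult_left_mono) auto
          moreover have "0 \<le> M * ?K" using M by simp
          moreover have "y \<notin> ball x0 \<rho>"
            using False by (simp add: z_def dist_norm norm_minus_commute)
          ultimately show ?thesis
            unfolding H_def z_def[symmetric] M_def[symmetric] by (simp add: algebra_simps)
        qed
      qed auto
      moreover have "(\<integral>y. H y \<partial>lborel)
          = M / 4 / E * (\<omega> * \<rho> ^ ?n) - M * C2 / d\<^sup>2 * (\<rho> powr (2 - 2 * s) * c1) - Q * I"
        unfolding H_def I_def using ints \<rho>
        by (simp add: Bochner_Integration.integral_diff
            integral_kern_near_scaled(2)[OF s] c1_def \<omega>_def content_ball)
      ultimately have "M / 4 / E * (\<omega> * \<rho> ^ ?n) - M * C2 / d\<^sup>2 * (\<rho> powr (2 - 2 * s) * c1) \<le> Q * I"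
        by simp
      \<comment> \<open>After multiplication by \<open>E\<close>, the gain and the curvature cost
        are both multiples of M \<rho>^n, with factors \<omega>/4 and at most \<omega>/8.\<close>
      then have "E * (M / 4 / E * (\<omega> * \<rho> ^ ?n) - M * C2 / d\<^sup>2 * (\<rho> powr (2 - 2 * s) * c1)) \<le> E * (Q * I)"
        using E by (intro mult_left_mono) auto
      moreover have "M * \<rho> ^ ?n * (C2 * c1 * r\<^sup>2) \<le> M * \<rho> ^ ?n * (\<omega> / 8)"
        using r3 M \<rho> by (intro mult_left_mono) auto
      moreover have "E * (M / 4 / E * (\<omega> * \<rho> ^ ?n)) = 2 * (M * \<rho> ^ ?n * (\<omega> / 8))"
        using E by (simp add: mult_ac)
      ultimately have "M * \<rho> ^ ?n * (\<omega> / 8) \<le> E * (Q * I)"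
        using E_term unfolding right_diff_distrib by linarith
      moreover have "E * (Q * I) = (1 + 2 powr ?p) * I" using E by (simp add: Q_def)
      moreover have "M * \<rho> ^ ?n = t * r ^ ?n" by (simp add: t_def \<rho>_def power_mult_distrib)
      ultimately have "t * (r ^ ?n * (\<omega> / 8)) \<le> (1 + 2 powr ?p) * I"
        by (simp only: mult.assoc)
      moreover have "0 < r ^ ?n * (\<omega> / 8)" using c r0 by simp
      ultimately have "t \<le> (1 + 2 powr ?p) * I / (r ^ ?n * (\<omega> / 8))"
        by (subst pos_le_divide_eq)
      also have "\<dots> = C * I" by (simp add: C_def mult_ac)
      finally have "t \<le> C * I" .
      then show ?thesis using t unfolding I_def by simp
    qed
  qed
  then show ?thesis using C0 by blast
qed

section \<open>Comparison of values at all scales and rigidity\<close>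

lemma Harnack:
  assumes s: "0 < s" "s < 1"
  shows "\<exists>C. \<forall>u::'a::euclidean_space \<Rightarrow> real. s_harmonic s u \<longrightarrow> (\<forall>x. 0 \<le> u x) \<longrightarrow> (\<forall>x y. u x \<le> C * u y)"
proof -
  obtain A B where A: "0 \<le> A" "\<And>u::'a \<Rightarrow> real. s_harmonic s u \<Longrightarrow> \<forall>x. 0 \<le> u x \<Longrightarrow>
      u 0 \<le> A * (\<integral>y. u y * wt s y \<partial>lborel)"
    and B: "\<And>(u::'a \<Rightarrow> real) x. s_harmonic s u \<Longrightarrow> \<forall>x. 0 \<le> u x \<Longrightarrow> norm x \<le> 1 \<Longrightarrow>
      (\<integral>y. u y * wt s y \<partial>lborel) \<le> B * u x"
    using local_boundedness[OF s, where 'a='a] weak_Harnack[OF s, where 'a='a] by blast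
  have "u x \<le> A * B * u y" if u: "s_harmonic s u" and nonneg: "\<forall>x. 0 \<le> u x" for u :: "'a \<Rightarrow> real" and x y
  proof -
    \<comment> \<open>This dilation moves \<open>x\<close> to the origin and \<open>y\<close> into
      the unit ball; the added 1 keeps \<open>R\<close> positive when the points coincide.\<close>
    define R where "R = norm (y - x) + 1"
    define v where "v z = u (x + R *\<^sub>R z)" for z
    have R: "0 < R" by (simp add: R_def add_nonneg_pos)
    have v: "s_harmonic s v" "\<forall>z. 0 \<le> v z"
      unfolding v_def using s_harmonic_affine[OF s(1) u R] nonneg by auto
    define w where "w = (1 / R) *\<^sub>R (y - x)"
    have "norm w \<le> 1" using R by (simp add: w_def R_def)
    then have "v 0 \<le> A * (B * v w)"
      using A(2)[OF v] B[OF v, of w] mult_left_mono[OF _ A(1)] order_trans by blast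
    moreover have "v 0 = u x" "v w = u y" using R by (simp_all add: v_def w_def)
    ultimately show ?thesis by simp
  qed
  then show ?thesis by blast
qed

lemma s_harmonic_nonneg_const:
  fixes u :: "'a::euclidean_space \<Rightarrow> real"
  assumes s: "0 < s" "s < 1" and u: "s_harmonic s u" and nonneg: "\<And>x. 0 \<le> u x"
  shows "\<exists>c. \<forall>x. u x = c"
proof -
  define m where "m = Inf (range u)"
  have bdd: "bdd_below (range u)" using nonneg by (auto intro: bdd_belowI[of _ 0])
  have m: "m \<le> u x" for x unfolding m_def using bdd by (simp add: cInf_lower)
  obtain C where C: "\<And>u::'a \<Rightarrow> real. s_harmonic s u \<Longrightarrow> \<forall>x. 0 \<le> u x \<Longrightarrow> \<forall>x y. u x \<le> C * u y"
    using Harnack[OF s, where 'a='a] by blast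
  have H: "u x - m \<le> C * (u y - m)" for x y
    using C[OF s_harmonic_diff_const[OF s(1) u, of m]] m by simp
  have "u x = m" for x
  proof (rule ccontr)
    assume "u x \<noteq> m"
    then have pos: "0 < u x - m" using m[of x] by simp
    then have C0: "0 < C" using H[of x x] by (smt (verit) mult_nonpos_nonneg)
    \<comment> \<open>A near-minimising point \<open>y\<close> is chosen so that the Harnack bound
      would make \<open>u x - m\<close> smaller than half of itself.\<close>
    have "m < m + (u x - m) / (2 * C)" using pos C0 by simp
    then obtain y where "u y < m + (u x - m) / (2 * C)"
      using cInf_lessD[of "range u" "m + (u x - m) / (2 * C)"] by (auto simp flip: m_def)
    then have "C * (u y - m) < C * ((u x - m) / (2 * C))"
      using C0 by (intro mult_strict_left_mono) auto
    also have "\<dots> = (u x - m) / 2" using C0 by simp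
    finally show False using H[of x y] pos by simp
  qed
  then show ?thesis by blast
qed

section \<open>The Liouville theorem\<close>

text \<open>If the integral defining the constant diverged, its value would be the junk value 0 and
  \<open>has_frac_lap\<close> would hold vacuously.\<close>

lemma frac_const_nonzero:
  assumes s: "0 < s" "s < 1"
  shows "frac_const TYPE('a::euclidean_space) s \<noteq> 0"
proof -
  define b :: 'a where "b = (SOME b. b \<in> Basis)"
  have b: "b \<in> Basis" unfolding b_def by (rule someI_ex) (use nonempty_Basis in blast)
  define f where "f \<zeta> = (1 - cos (\<zeta> \<bullet> b)) * kern s \<zeta>" for \<zeta> :: 'a
  have f0: "0 \<le> f \<zeta>" for \<zeta> by (simp add: f_def)
  have f: "integrable lborel f"
  proof (rule Bochner_Integration.integrable_bound)
    show "integrable lborel (\<lambda>\<zeta>::'a. indicator (ball 0 1) \<zeta> * ((norm \<zeta>)\<^sup>2 * kern s \<zeta>)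
        + 2 * (indicator (- ball 0 1) \<zeta> * kern s \<zeta>))"
      using integrable_kern_near[OF s, where 'a='a] integrable_kern_far[OF s(1), where 'a='a]
      by (intro Bochner_Integration.integrable_add integrable_mult_right) auto
    have "f \<zeta> \<le> indicator (ball 0 1) \<zeta> * ((norm \<zeta>)\<^sup>2 * kern s \<zeta>)
        + 2 * (indicator (- ball 0 1) \<zeta> * kern s \<zeta>)" for \<zeta>
    proof -
      \<comment> \<open>The half-angle formula gives quadratic vanishing at the origin, matching the
        singularity that \<open>integrable_kern_near\<close> admits.\<close>
      have "1 - cos (\<zeta> \<bullet> b) = 2 * (sin ((\<zeta> \<bullet> b) / 2))\<^sup>2"
        using cos_double_sin[of "(\<zeta> \<bullet> b) / 2"] by simp
      also have "(sin ((\<zeta> \<bullet> b) / 2))\<^sup>2 \<le> ((\<zeta> \<bullet> b) / 2)\<^sup>2"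
        using abs_sin_x_le_abs_x by (simp only: abs_le_square_iff)
      also have "((\<zeta> \<bullet> b) / 2)\<^sup>2 \<le> (norm \<zeta> / 2)\<^sup>2"
        using Basis_le_norm[OF b, of \<zeta>] by (intro iffD1[OF abs_le_square_iff]) simp
      also have "2 * (norm \<zeta> / 2)\<^sup>2 \<le> (norm \<zeta>)\<^sup>2"
        by (simp add: power_divide)
      finally have "1 - cos (\<zeta> \<bullet> b) \<le> (norm \<zeta>)\<^sup>2" by simp
      moreover have "1 - cos (\<zeta> \<bullet> b) \<le> 2" using cos_ge_minus_one[of "\<zeta> \<bullet> b"] by linarith
      ultimately show ?thesis
        unfolding f_def by (cases "\<zeta> \<in> ball 0 1") (auto intro: mult_right_mono simp flip: mult.assoc)
    qed
    then show "AE \<zeta> in lborel. norm (f \<zeta>) \<le> norm (indicator (ball 0 1) \<zeta> * ((norm \<zeta>)\<^sup>2 * kern s \<zeta>)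
        + 2 * (indicator (- ball 0 1) \<zeta> * kern s \<zeta>))"
      using f0 unfolding real_norm_def by (intro always_eventually allI) (smt (verit))
    show "f \<in> borel_measurable lborel" unfolding f_def by measurable
  qed
  have "(\<integral>\<zeta>. f \<zeta> \<partial>lborel) \<noteq> 0"
  proof
    assume "(\<integral>\<zeta>. f \<zeta> \<partial>lborel) = 0"
    then have ae: "AE \<zeta> in lborel. f \<zeta> = 0"
      using integral_nonneg_eq_0_iff_AE[OF f] f0 by simp
    \<comment> \<open>On this ball the coordinate along \<open>b\<close> stays between 1/4 and 3/4,
      where the cosine is below 1; a ball of positive volume then contradicts vanishing almost
      everywhere.\<close>
    let ?B = "ball ((1/2) *\<^sub>R b) (1/4)"
    have nz: "f \<zeta> \<noteq> 0" if "\<zeta> \<in> ?B" for \<zeta>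
    proof -
      have "\<bar>(\<zeta> - (1/2) *\<^sub>R b) \<bullet> b\<bar> < 1 / 4"
        using Basis_le_norm[OF b, of "\<zeta> - (1/2) *\<^sub>R b"] that by (simp add: dist_norm norm_minus_commute)
      then have \<zeta>: "\<bar>\<zeta> \<bullet> b - 1 / 2\<bar> < 1 / 4" using b by (simp add: inner_diff_left)
      then have *: "0 < \<zeta> \<bullet> b" "\<zeta> \<bullet> b \<le> pi" using pi_gt3 by linarith+
      then have "cos (\<zeta> \<bullet> b) < cos 0" by (intro cos_monotone_0_pi) auto
      moreover have "\<zeta> \<noteq> 0" using *(1) by auto
      ultimately show ?thesis by (simp add: f_def kern_def)
    qed
    have "AE \<zeta> in lborel. \<zeta> \<notin> ?B"
      using ae by eventually_elim (use nz in blast)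
    moreover have "{\<zeta> \<in> space lborel. \<not> \<zeta> \<notin> ?B} = ?B" by auto
    moreover have "?B \<in> sets lborel" by simp
    ultimately have "emeasure lborel ?B = 0"
      using AE_iff_measurable[of ?B lborel "\<lambda>\<zeta>. \<zeta> \<notin> ?B"] by (simp only:)
    then have "measure lborel ?B = 0" by (simp add: measure_def)
    then show False using content_ball_eq_0_iff[of "(1/2) *\<^sub>R b" "1/4"] by linarith
  qed
  then show ?thesis
    by (simp add: frac_const_def f_def[abs_def] kern_def b_def)
qed

section \<open>From the hypotheses of the theorem to s-harmonicity\<close>

text \<open>The weight has finite total mass, so square integrability against it implies
  integrability, through |u| \<le> 1 + u^2.\<close>

lemma Lps_two_imp_integrable:
  fixes u :: "'a::euclidean_space \<Rightarrow> real"
  assumes s: "0 < s" and u: "Lps 2 s u"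
  shows "integrable lborel (\<lambda>y. u y * wt s y)"
proof (rule Bochner_Integration.integrable_bound)
  have [measurable]: "u \<in> borel_measurable borel"
    using u by (simp add: Lps_def L1_loc_def)
  have eq: "\<bar>u y\<bar> powr 2 / (1 + norm y powr (real DIM('a) + 2 * s)) = (u y)\<^sup>2 * wt s y" for y
    by (cases "u y = 0") (simp_all add: wt_def powr_numeral)
  have "integrable lborel (\<lambda>y. (u y)\<^sup>2 * wt s y)"
  proof (rule integrableI_nonneg)
    show "(\<integral>\<^sup>+y. ennreal ((u y)\<^sup>2 * wt s y) \<partial>lborel) < \<infinity>"
      using u unfolding Lps_def eq by blast
  qed auto
  then show "integrable lborel (\<lambda>y. wt s y + (u y)\<^sup>2 * wt s y)"
    using integrable_wt[OF s] by (intro Bochner_Integration.integrable_add) auto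
  have "\<bar>u y\<bar> * wt s y \<le> (1 + (u y)\<^sup>2) * wt s y" for y
  proof (rule mult_right_mono)
    show "\<bar>u y\<bar> \<le> 1 + (u y)\<^sup>2"
      using zero_le_power2[of "\<bar>u y\<bar> - 1"] zero_le_power2[of "u y"] by (simp add: power2_diff)
  qed auto
  then show "AE y in lborel. norm (u y * wt s y) \<le> norm (wt s y + (u y)\<^sup>2 * wt s y)"
    by (simp add: abs_mult algebra_simps)
  show "(\<lambda>y. u y * wt s y) \<in> borel_measurable lborel" by measurable
qed

lemma Ck_on_UNIV_imp_continuous: "Ck_on_UNIV k f \<Longrightarrow> continuous_on UNIV f"
  by (cases k) (simp_all add: differentiable_imp_continuous_on differentiable_on_def)

lemma has_frac_lap_zero_imp_tendsto:
  fixes u :: "'a::euclidean_space \<Rightarrow> real"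
  assumes s: "0 < s" "s < 1" and u: "has_frac_lap s u x 0"
  shows "((\<lambda>\<epsilon>. \<integral>y\<in>(UNIV - ball x \<epsilon>). (u x - u y) * kern s (y - x) \<partial>lborel) \<longlongrightarrow> 0) (at_right 0)"
proof -
  have "(u x - u y) / norm (x - y) powr (real DIM('a) + 2 * s) = (u x - u y) * kern s (y - x)" for y
    by (simp add: kern_def norm_minus_commute)
  with u have "((\<lambda>\<epsilon>. frac_const TYPE('a) s *
      (\<integral>y\<in>(UNIV - ball x \<epsilon>). (u x - u y) * kern s (y - x) \<partial>lborel)) \<longlongrightarrow> 0) (at_right 0)"
    by (simp add: has_frac_lap_def)
  from tendsto_mult_left[OF this, of "1 / frac_const TYPE('a) s"] show ?thesis
    using frac_const_nonzero[OF s, where 'a='a] by simp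
qed

theorem theorem5p4:
  fixes u :: "'a::euclidean_space \<Rightarrow> real" and s :: real
  assumes "0 < s" and "s < 1"
    and "Ck_on_UNIV 3 u"
    and "Lps 2 s u"
    and "G_in_L1s s u"
    and "\<forall>x. has_frac_lap s u x 0"
    and "(\<exists>M. \<forall>x. u x \<le> M) \<or> (\<exists>M. \<forall>x. M \<le> u x)"
  shows "\<exists>c. \<forall>x. u x = c"
proof -
  have u: "s_harmonic s u"
    unfolding s_harmonic_def
    using Ck_on_UNIV_imp_continuous[OF assms(3)] Lps_two_imp_integrable[OF assms(1,4)]
      has_frac_lap_zero_imp_tendsto[OF assms(1,2)] assms(6) by blast
  from assms(7) show ?thesis
  proof (elim disjE exE)
    \<comment> \<open>An upper bound is turned into a lower one by passing to M - u, written as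
      \<open>- u x - - M\<close> to fit the two closure lemmas.\<close>
    fix M assume "\<forall>x. u x \<le> M"
    then obtain c where "\<forall>x. - u x - - M = c"
      using s_harmonic_nonneg_const[OF assms(1,2) s_harmonic_diff_const[OF assms(1) s_harmonic_minus[OF u], of "- M"]]
      by auto
    then have "\<forall>x. u x = M - c" by (auto simp: algebra_simps)
    then show ?thesis by blast
  next
    fix M assume "\<forall>x. M \<le> u x"
    then obtain c where "\<forall>x. u x - M = c"
      using s_harmonic_nonneg_const[OF assms(1,2) s_harmonic_diff_const[OF assms(1) u, of M]] by auto
    then have "\<forall>x. u x = c + M" by (auto simp: algebra_simps)
    then show ?thesis by blast
  qed
qed

end
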